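(* Let $X$ be a Banach space which does not have the Radon-Nikodým property. Then there exist a metric space $M_X$, points $u,v\in M_X$, and a nonempty thick family $T_X$ of $uv$-geodesics in $M_X$, such that $M_X$ admits a bilipschitz embedding into $X$.
   Context: Banach spaces are real. Bilipschitz embedding: a map $f:M\to X$ from a metric space $(M,d_M)$ to a Banach space $X$ is a bilipschitz embedding if there are constants $0<c\le C<\infty$ such that $c\,d_M(a,b)\le \|f(a)-f(b)\|\le C\,d_M(a,b)$ for all $a,b\in M$. Geodesics: let $u,v$ be two elements of a metric space $(M,d_M)$. A $uv$-geodesic is a distance-preserving map $g:[0,d_M(u,v)]\to M$ with $g(0)=u$ and $g(d_M(u,v))=v$, where $[0,d_M(u,v)]\subset\mathbb{R}$ carries the usual distance. Thick family: a family $T$ of $uv$-geodesics in $M$ is called thick if there is $\alpha>0$ such that for every $g\in T$ and every finite collection of points $r_1,\dots,r_n$ in the image of $g$, there is another $uv$-geodesic $\widetilde g\in T$ satisfying: - The image of $\widetilde g$ also contains $r_1,\dots,r_n$; therefore there are $t_1,\dots,t_n\in[0,d_M(u,v)]$ with $r_i=g(t_i)=\widetilde g(t_i)$ for all $i$. - There are two finite sequences $\{q_i\}_{i=1}^m$ and $\{s_i\}_{i=1}^{m+1}$ in $[0,d_M(u,v)]$, listed in non-decreasing order, such that: (1) $\{q_i\}_{i=1}^m$ contains $\{t_i\}_{i=1}^n$; (2) $0\le s_1\le q_1\le s_2\le q_2\le\dots\le s_m\le q_m\le s_{m+1}\le d_M(u,v)$; (3) $g(q_i)=\widetilde g(q_i)$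 for all $i=1,\dots,m$, and $\sum_{i=1}^{m+1}d_M(g(s_i),\widetilde g(s_i))\ge\alpha$. *)

theory Defs
  imports "HOL-Analysis.Analysis"
begin

section \<open>The Radon-Nikodym property\<close>

text \<open>
  The library's \<^const>\<open>has_bochner_integral\<close> is restricted to second countable (hence separable)
  spaces. The Bochner integral below works in an arbitrary normed space; plain Borel measurability
  is replaced by strong measurability, which is the right notion there.
\<close>

definition strongly_measurable :: "'w measure \<Rightarrow> ('w \<Rightarrow> 'x::real_normed_vector) \<Rightarrow> bool" where
  "strongly_measurable \<mu> f \<longleftrightarrow>
     (\<exists>s. (\<forall>k::nat. simple_function \<mu> (s k)) \<and> (AE w in \<mu>. (\<lambda>k. s k w) \<longlonglongrightarrow> f w))"

definition has_strong_bochner_integral ::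
    "'w measure \<Rightarrow> ('w \<Rightarrow> 'x::real_normed_vector) \<Rightarrow> 'x \<Rightarrow> bool" where
  "has_strong_bochner_integral \<mu> f x \<longleftrightarrow>
     strongly_measurable \<mu> f \<and>
     (\<exists>s. (\<forall>k::nat. Bochner_Integration.simple_bochner_integrable \<mu> (s k)) \<and>
          (\<lambda>k. \<integral>\<^sup>+ w. ennreal (norm (f w - s k w)) \<partial>\<mu>) \<longlonglongrightarrow> 0 \<and>
          (\<lambda>k. Bochner_Integration.simple_bochner_integral \<mu> (s k)) \<longlonglongrightarrow> x)"

text \<open>
  Set functions are total in HOL; only the values on \<^term>\<open>sets \<mu>\<close> matter. The measure \<open>\<mu>\<close> enters
  the next two definitions only through its sigma-algebra.
\<close>

definition vector_measure_on :: "'w measure \<Rightarrow> ('w set \<Rightarrow> 'x::real_normed_vector) \<Rightarrow> bool" where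
  "vector_measure_on \<mu> \<nu> \<longleftrightarrow>
     (\<forall>A::nat \<Rightarrow> 'w set. range A \<subseteq> sets \<mu> \<longrightarrow> disjoint_family A \<longrightarrow>
        (\<lambda>k. \<nu> (A k)) sums \<nu> (\<Union>k. A k))"

definition bounded_variation_on :: "'w measure \<Rightarrow> ('w set \<Rightarrow> 'x::real_normed_vector) \<Rightarrow> bool" where
  "bounded_variation_on \<mu> \<nu> \<longleftrightarrow>
     (\<exists>K::real. \<forall>P. finite P \<longrightarrow> P \<subseteq> sets \<mu> \<longrightarrow> partition_on (space \<mu>) P \<longrightarrow>
        (\<Sum>E\<in>P. norm (\<nu> E)) \<le> K)"

definition vanishes_on_null_sets :: "'w measure \<Rightarrow> ('w set \<Rightarrow> 'x::real_normed_vector) \<Rightarrow> bool" where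
  "vanishes_on_null_sets \<mu> \<nu> \<longleftrightarrow> (\<forall>E\<in>null_sets \<mu>. \<nu> E = 0)"

definition RNP_wrt :: "'w measure \<Rightarrow> 'x::banach itself \<Rightarrow> bool" where
  "RNP_wrt \<mu> X \<longleftrightarrow>
     (\<forall>\<nu> :: 'w set \<Rightarrow> 'x.
        vector_measure_on \<mu> \<nu> \<longrightarrow> bounded_variation_on \<mu> \<nu> \<longrightarrow> vanishes_on_null_sets \<mu> \<nu> \<longrightarrow>
        (\<exists>f :: 'w \<Rightarrow> 'x. \<forall>E\<in>sets \<mu>.
           has_strong_bochner_integral \<mu> (\<lambda>w. indicator E w *\<^sub>R f w) (\<nu> E)))"

text \<open>
  A Banach space has the Radon-Nikodym property if it has it with respect to every finite measure
  space. HOL cannot quantify over the type \<open>'w\<close> of points of the measure space inside a formula, so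
  that type is a parameter: \<open>RNP TYPE('w) TYPE('x)\<close> covers all finite measure spaces with points
  in \<open>'w\<close>. In a theorem with hypothesis \<open>\<not> RNP TYPE('w) TYPE('x)\<close> and \<open>'w\<close> occurring nowhere else,
  the outer universal quantification over \<open>'w\<close> means exactly that the property fails for some
  finite measure space, over whatever type.
\<close>

definition RNP :: "'w itself \<Rightarrow> 'x::banach itself \<Rightarrow> bool" where
  "RNP W X \<longleftrightarrow> (\<forall>\<mu> :: 'w measure. finite_measure \<mu> \<longrightarrow> RNP_wrt \<mu> X)"


section \<open>Thick families of geodesics and bilipschitz embeddings\<close>

text \<open>
  Metric spaces are carriers \<open>M\<close> with a distance \<open>d\<close> as in \<^locale>\<open>Metric_space\<close>. Geodesics are total
  functions on \<^typ>\<open>real\<close>, of which only the restriction to \<open>{0..d u v}\<close> is relevant.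
\<close>

definition geodesic ::
    "'m set \<Rightarrow> ('m \<Rightarrow> 'm \<Rightarrow> real) \<Rightarrow> 'm \<Rightarrow> 'm \<Rightarrow> (real \<Rightarrow> 'm) \<Rightarrow> bool" where
  "geodesic M d u v g \<longleftrightarrow>
     g \<in> {0..d u v} \<rightarrow> M \<and>
     (\<forall>s\<in>{0..d u v}. \<forall>t\<in>{0..d u v}. d (g s) (g t) = \<bar>s - t\<bar>) \<and>
     g 0 = u \<and> g (d u v) = v"

text \<open>
  The interlacing chain of the \<open>s i\<close> and \<open>q i\<close> already makes both sequences non-decreasing with values
  in \<open>{0..d u v}\<close>. The new geodesic \<open>h\<close> differs from \<open>g\<close> because \<open>\<alpha> > 0\<close>.
\<close>

definition thick_family ::
    "'m set \<Rightarrow> ('m \<Rightarrow> 'm \<Rightarrow> real) \<Rightarrow> 'm \<Rightarrow> 'm \<Rightarrow> (real \<Rightarrow> 'm) set \<Rightarrow> bool" where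
  "thick_family M d u v T \<longleftrightarrow>
     (\<forall>g\<in>T. geodesic M d u v g) \<and>
     (\<exists>\<alpha>>0. \<forall>g\<in>T. \<forall>(n::nat) (r :: nat \<Rightarrow> 'm).
        (\<forall>i\<in>{1..n}. r i \<in> g ` {0..d u v}) \<longrightarrow>
        (\<exists>h\<in>T. \<exists>(t :: nat \<Rightarrow> real) (m::nat) (q :: nat \<Rightarrow> real) (s :: nat \<Rightarrow> real).
           (\<forall>i\<in>{1..n}. t i \<in> {0..d u v} \<and> r i = g (t i) \<and> r i = h (t i)) \<and>
           t ` {1..n} \<subseteq> q ` {1..m} \<and>
           0 \<le> s 1 \<and> (\<forall>i\<in>{1..m}. s i \<le> q i \<and> q i \<le> s (i + 1)) \<and> s (m + 1) \<le> d u v \<and>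
           (\<forall>i\<in>{1..m}. g (q i) = h (q i)) \<and>
           (\<Sum>i=1..m+1. d (g (s i)) (h (s i))) \<ge> \<alpha>))"

text \<open>
  A bilipschitz embedding is injective, so every metric space admitting one into a space of type
  \<open>'x\<close> is isometric to some \<open>(M, d)\<close> with \<open>M :: 'x set\<close> and \<open>d\<close> an arbitrary metric on \<open>M\<close>, unrelated to
  the norm metric. Existence of such a space may thus be stated over carriers of that type.
\<close>

definition bilipschitz_embedding ::
    "'m set \<Rightarrow> ('m \<Rightarrow> 'm \<Rightarrow> real) \<Rightarrow> ('m \<Rightarrow> 'x::real_normed_vector) \<Rightarrow> bool" where
  "bilipschitz_embedding M d f \<longleftrightarrow>
     (\<exists>c C. 0 < c \<and> c \<le> C \<and>
        (\<forall>a\<in>M. \<forall>b\<in>M. c * d a b \<le> norm (f a - f b) \<and> norm (f a - f b) \<le> C * d a b))"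

end

theory Submission
  imports Defs
begin

text \<open>
  Suppose that \<open>\<nu>\<close> is a measure with values in the space that has no density with respect to \<open>\<mu>\<close>. If
  every set of positive measure could be shrunk to one on which the averages \<open>\<nu> G / \<mu> G\<close> are nearly
  constant, then cutting the space into such pieces would give step functions that converge uniformly
  almost everywhere to a density (\<open>density_exists\<close>). Hence somewhere the averages keep oscillating by
  a fixed amount \<open>\<epsilon>\<close> on all subsets. Exhausting a set \<open>F\<close> by pieces whose averages are far from that
  of \<open>F\<close> writes the average of \<open>F\<close> as a convex combination of averages that are, in weighted mean, at
  distance at least \<open>\<epsilon> / 4\<close> from it (\<open>oscillating_split\<close>). The averages are bounded after a further
  shrinking, and a small correction in one direction moves them into a hyperplane \<open>\<phi> = 1\<close> of a
  continuous functional. The result is a bush: a bounded set \<open>B\<close> in this hyperplane, each \<open>b\<close> of which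
  is a finite convex combination \<open>b = (\<Sum>i. w i * \<beta> i)\<close> of elements \<open>\<beta> i\<close> of \<open>B\<close> with
  \<open>(\<Sum>i. w i * norm (b - \<beta> i)) \<ge> \<delta>\<close> (\<open>bush_exists\<close>).
  
  The hyperplane makes geodesics cheap. A curve that moves in directions from \<open>B\<close> satisfies \<open>\<phi> (g t) = t\<close>
  and is \<open>C\<close>-Lipschitz for the norm, where \<open>C\<close> bounds \<open>B\<close>; so it is a geodesic for the metric
  \<open>max \<bar>\<phi> (x - y)\<bar> (norm (x - y) / C)\<close> on the whole space. That metric is equivalent to the norm, and
  the identity is the required embedding.
  
  It remains to branch. Unit time spent in direction \<open>b\<close> can be replaced by consecutive intervals of
  lengths \<open>w i\<close>, on each of which half of the time goes to \<open>b\<close> and half to \<open>\<beta> i\<close>; the total displacement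
  is still \<open>b\<close>. Exchanging the two halves of the \<open>i\<close>-th interval fixes its end points and moves its
  midpoint by \<open>w i / 2 * norm (b - \<beta> i)\<close>, in total by at least \<open>\<delta> / 2\<close>. A mere rearrangement of the
  \<open>\<beta> i\<close> would not do, since the new curve need not return to the old one after each of them. The thick
  family consists of the curves that decompose in this way at all scales (\<open>branching\<close>). Each step halves
  the lengths at least, so on a fine enough scale the intervals containing finitely many prescribed
  points take up at most half of the time, and exchanging halves in the others still produces a
  deviation of \<open>\<delta> / 4\<close> (\<open>branching_deviates\<close>).
\<close>

section \<open>Norming functionals\<close>

definition sublinear :: "('x::real_vector \<Rightarrow> real) \<Rightarrow> bool" where
  "sublinear q \<longleftrightarrow> (\<forall>x y. q (x + y) \<le> q x + q y) \<and> (\<forall>t x. 0 \<le> t \<longrightarrow> q (t *\<^sub>R x) = t * q x)"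

lemma sublinear_lower_bound:
  assumes "sublinear q" shows "- q (- x) \<le> q x"
proof -
  have "q (0 *\<^sub>R x) = 0 * q x" using assms unfolding sublinear_def by blast
  moreover have "q (x + - x) \<le> q x + q (- x)" using assms unfolding sublinear_def by blast
  ultimately show ?thesis by simp
qed

text \<open>
  By subadditivity the expression decreases in \<open>t\<close>. Passing to its limit yields a minorant of
  \<open>q\<close> that is affine along \<open>y\<close>: it is still sublinear, and its value at \<open>- y\<close> is only \<open>- q y\<close>.
\<close>

definition straighten :: "('x::real_vector \<Rightarrow> real) \<Rightarrow> 'x \<Rightarrow> 'x \<Rightarrow> real" where
  "straighten q y x = (INF t\<in>{0..}. q (x + t *\<^sub>R y) - t * q y)"

lemma straighten:
  fixes q :: "'x::real_vector \<Rightarrow> real"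
  assumes q: "sublinear q"
  shows sublinear_straighten: "sublinear (straighten q y)"
    and straighten_le: "0 \<le> t \<Longrightarrow> straighten q y x \<le> q (x + t *\<^sub>R y) - t * q y"
proof -
  have add: "q (x + z) \<le> q x + q z" for x z using q unfolding sublinear_def by blast
  have hom: "0 \<le> t \<Longrightarrow> q (t *\<^sub>R x) = t * q x" for t x using q unfolding sublinear_def by blast
  have lb: "- q (- x) \<le> q (x + t *\<^sub>R y) - t * q y" if "0 \<le> t" for t x
    using add[of "x + t *\<^sub>R y" "- x"] hom[OF that, of y] by simp
  have bdd: "bdd_below ((\<lambda>t. q (x + t *\<^sub>R y) - t * q y) ` {0..})" for x
    by (rule bdd_belowI2[where m="- q (- x)"]) (use lb in auto)
  show le: "straighten q y x \<le> q (x + t *\<^sub>R y) - t * q y" if "0 \<le> t" for t x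
    unfolding straighten_def by (rule cINF_lower[OF bdd]) (use that in auto)
  have ge: "c \<le> straighten q y x" if "\<And>t. 0 \<le> t \<Longrightarrow> c \<le> q (x + t *\<^sub>R y) - t * q y" for c x
    unfolding straighten_def by (rule cINF_greatest) (use that in auto)
  have add': "straighten q y (x + z) \<le> straighten q y x + straighten q y z" for x z
  proof -
    have "straighten q y (x + z) - (q (z + u *\<^sub>R y) - u * q y) \<le> straighten q y x" if u: "0 \<le> u" for u
    proof (rule ge)
      fix t :: real assume t: "0 \<le> t"
      have "straighten q y (x + z) \<le> q ((x + z) + (t + u) *\<^sub>R y) - (t + u) * q y"
        using t u by (intro le) auto
      also have "q ((x + z) + (t + u) *\<^sub>R y) \<le> q (x + t *\<^sub>R y) + q (z + u *\<^sub>R y)"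
        using add[of "x + t *\<^sub>R y" "z + u *\<^sub>R y"] by (simp add: algebra_simps)
      finally show "straighten q y (x + z) - (q (z + u *\<^sub>R y) - u * q y) \<le> q (x + t *\<^sub>R y) - t * q y"
        by (simp add: algebra_simps)
    qed
    then have "straighten q y (x + z) - straighten q y x \<le> straighten q y z"
      by (intro ge) (force simp: algebra_simps)
    then show ?thesis by simp
  qed
  have hom_le: "straighten q y (s *\<^sub>R x) \<le> s * straighten q y x" if s: "0 < s" for s x
  proof -
    have "straighten q y (s *\<^sub>R x) / s \<le> straighten q y x"
    proof (rule ge)
      fix t :: real assume t: "0 \<le> t"
      have "straighten q y (s *\<^sub>R x) \<le> q (s *\<^sub>R x + (s * t) *\<^sub>R y) - (s * t) * q y"
        using s t by (intro le) auto
      also have "q (s *\<^sub>R x + (s * t) *\<^sub>R y) = s * q (x + t *\<^sub>R y)"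
        using hom[of s "x + t *\<^sub>R y"] s by (simp add: algebra_simps)
      finally show "straighten q y (s *\<^sub>R x) / s \<le> q (x + t *\<^sub>R y) - t * q y"
        using s by (simp add: divide_simps algebra_simps)
    qed
    then show ?thesis using s by (simp add: divide_simps algebra_simps)
  qed
  have hom': "straighten q y (s *\<^sub>R x) = s * straighten q y x" if "0 \<le> s" for s x
  proof (cases "s = 0")
    case True
    have "straighten q y 0 \<le> 0" using le[of 0 0] hom[of 0 0] by simp
    moreover have "0 \<le> straighten q y 0" by (rule ge) (use hom in auto)
    ultimately show ?thesis using True by simp
  next
    case False
    with that have s: "0 < s" by simp
    have "straighten q y ((1/s) *\<^sub>R (s *\<^sub>R x)) \<le> (1/s) * straighten q y (s *\<^sub>R x)"
      by (rule hom_le) (use s in auto)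
    then have "s * straighten q y x \<le> straighten q y (s *\<^sub>R x)" using s by (simp add: divide_simps algebra_simps)
    with hom_le[OF s] show ?thesis by (simp add: antisym)
  qed
  show "sublinear (straighten q y)" unfolding sublinear_def using add' hom' by blast
qed

text \<open>
  Zorn's lemma applies because the infimum of a chain of sublinear functionals below \<open>p\<close> is sublinear:
  it is finite, as each member is at least \<open>- p (- x)\<close> at \<open>x\<close>, and it is subadditive, as of any two members
  one is below the other at both points.
\<close>

lemma minimal_sublinear_exists:
  fixes p :: "'x::real_vector \<Rightarrow> real"
  assumes p: "sublinear p"
  shows "\<exists>q. sublinear q \<and> q \<le> p \<and> (\<forall>r. sublinear r \<longrightarrow> r \<le> q \<longrightarrow> r = q)"
proof -
  define S where "S = {q. sublinear q \<and> q \<le> p}"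
  have "\<exists>m\<in>S. \<forall>a\<in>S. a \<le> m \<longrightarrow> a = m"
  proof (rule predicate_Zorn)
    show "partial_order_on S (relation_of (\<lambda>a b. b \<le> a) S)"
      by (rule partial_order_on_relation_ofI) auto
  next
    fix K assume K: "K \<in> Chains (relation_of (\<lambda>a b. b \<le> a) S)"
    show "\<exists>u\<in>S. \<forall>a\<in>K. u \<le> a"
    proof (cases "K = {}")
      case True then show ?thesis using p by (auto simp: S_def)
    next
      case False
      have KS: "K \<subseteq> S" and tot: "\<And>a b. a \<in> K \<Longrightarrow> b \<in> K \<Longrightarrow> a \<le> b \<or> b \<le> a"
        using K by (auto simp: Chains_def relation_of_def)
      have lb: "- p (- x) \<le> a x" if "a \<in> K" for a x
      proof -
        have "sublinear a" "a (- x) \<le> p (- x)" using that KS by (auto simp: S_def le_fun_def)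
        then show ?thesis using sublinear_lower_bound[of a x] by simp
      qed
      define u where "u x = (INF a\<in>K. a x)" for x
      have bdd: "bdd_below ((\<lambda>a. a x) ` K)" for x by (rule bdd_belowI2) (rule lb)
      have le: "u x \<le> a x" if "a \<in> K" for a x unfolding u_def by (rule cINF_lower[OF bdd that])
      have ge: "c \<le> u x" if "\<And>a. a \<in> K \<Longrightarrow> c \<le> a x" for c x
        unfolding u_def using False that by (rule cINF_greatest)
      have sub: "a (x + y) \<le> a x + a y" "0 \<le> t \<Longrightarrow> a (t *\<^sub>R x) = t * a x" if "a \<in> K" for a x y t
        using that KS by (auto simp: S_def sublinear_def)
      have add: "u (x + y) \<le> u x + u y" for x y
      proof -
        have *: "u (x + y) \<le> a x + b y" if a: "a \<in> K" and b: "b \<in> K" for a b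
          using tot[OF a b]
        proof
          assume "a \<le> b"
          then have "a y \<le> b y" by (simp add: le_fun_def)
          then show ?thesis using le[OF a, of "x + y"] sub(1)[OF a, of x y] by simp
        next
          assume "b \<le> a"
          then have "b x \<le> a x" by (simp add: le_fun_def)
          then show ?thesis using le[OF b, of "x + y"] sub(1)[OF b, of x y] by simp
        qed
        have "u (x + y) - b y \<le> u x" if "b \<in> K" for b by (rule ge) (use *[OF _ that] in force)
        then have "u (x + y) - u x \<le> u y" by (intro ge) force
        then show ?thesis by simp
      qed
      have hom: "u (t *\<^sub>R x) = t * u x" if t: "0 \<le> t" for t x
      proof (cases "t = 0")
        case True
        have "a 0 = 0" if "a \<in> K" for a using sub(2)[OF that, of 0 0] by simp
        then have "u 0 = (INF a\<in>K. 0::real)" unfolding u_def by (intro INF_cong) auto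
        then show ?thesis using True False by simp
      next
        case pos: False
        have "u (t *\<^sub>R x) / t \<le> u x"
          by (rule ge) (use t pos le sub(2) in \<open>auto simp: divide_simps mult.commute dest!: le[of _ "t *\<^sub>R x"]\<close>)
        moreover have "t * u x \<le> u (t *\<^sub>R x)"
          by (rule ge) (use t le sub(2) in \<open>fastforce intro: mult_left_mono\<close>)
        ultimately show ?thesis using t pos by (simp add: divide_simps mult.commute)
      qed
      obtain a where a: "a \<in> K" using False by blast
      then have "u \<le> a" using le by (simp add: le_fun_def)
      also have "a \<le> p" using a KS by (auto simp: S_def)
      finally have "u \<in> S" using add hom by (simp add: S_def sublinear_def)
      then show ?thesis using le by (auto simp: le_fun_def)
    qed
  qed
  then show ?thesis unfolding S_def using order_trans by blast
qed

text \<open>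
  A minimal \<open>q\<close> coincides with \<open>straighten q y\<close>, and this is the missing inequality \<open>q x + q y \<le> q (x + y)\<close>.
\<close>

lemma minimal_sublinear_linear:
  fixes q :: "'x::real_vector \<Rightarrow> real"
  assumes q: "sublinear q" and min: "\<And>r. sublinear r \<Longrightarrow> r \<le> q \<Longrightarrow> r = q"
  shows "linear q"
proof -
  have add: "q (x + y) = q x + q y" for x y
  proof (rule antisym)
    show "q (x + y) \<le> q x + q y" using q unfolding sublinear_def by blast
    have "straighten q y \<le> q" using straighten_le[OF q, of 0 y] by (simp add: le_fun_def)
    then have "straighten q y = q" by (intro min sublinear_straighten q)
    then show "q x + q y \<le> q (x + y)" using straighten_le[OF q, of 1 y x] by simp
  qed
  have hom: "q (t *\<^sub>R x) = t * q x" if "0 \<le> t" for t x using q that unfolding sublinear_def by blast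
  have "q 0 = 0" using hom[of 0 0] by simp
  then have neg: "q (- x) = - q x" for x using add[of x "- x"] by simp
  have "q (t *\<^sub>R x) = t *\<^sub>R q x" for t x
  proof (cases "0 \<le> t")
    case True then show ?thesis using hom by simp
  next
    case False then show ?thesis using hom[of "- t" x] neg[of "t *\<^sub>R x"] by simp
  qed
  with add show ?thesis by (rule linearI)
qed

text \<open>
  The minimal functional is sought below \<open>straighten norm x\<^sub>0\<close> rather than below the norm, because the
  former is at most \<open>- norm x\<^sub>0\<close> at \<open>- x\<^sub>0\<close>; this forces the value at \<open>x\<^sub>0\<close>.
\<close>

lemma norming_functional_exists:
  fixes x\<^sub>0 :: "'x::real_normed_vector"
  assumes "x\<^sub>0 \<noteq> 0"
  shows "\<exists>\<phi> :: 'x \<Rightarrow> real. bounded_linear \<phi> \<and> \<phi> x\<^sub>0 = norm x\<^sub>0"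
proof -
  have n: "sublinear (norm :: 'x \<Rightarrow> real)" by (auto simp: sublinear_def norm_triangle_ineq)
  obtain \<phi> where \<phi>: "sublinear \<phi>" "\<phi> \<le> straighten norm x\<^sub>0"
    and min: "\<And>r. sublinear r \<Longrightarrow> r \<le> \<phi> \<Longrightarrow> r = \<phi>"
    using minimal_sublinear_exists[OF sublinear_straighten[OF n]] by blast
  have lin: "linear \<phi>" using minimal_sublinear_linear[OF \<phi>(1) min] by blast
  have le: "\<phi> x \<le> norm x" for x
    using \<phi>(2) straighten_le[OF n, of 0 x\<^sub>0 x] by (simp add: le_fun_def) (meson order_trans)
  have neg: "\<phi> (- x) = - \<phi> x" for x using lin by (rule linear_neg)
  have "\<bar>\<phi> x\<bar> \<le> norm x" for x using le[of x] le[of "- x"] neg[of x] by simp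
  then have "bounded_linear \<phi>"
    using lin by (intro linear_conv_bounded_linear[THEN iffD1] bounded_linear_intro[of _ 1])
      (auto simp: linear_add linear_scale)
  moreover have "\<phi> x\<^sub>0 = norm x\<^sub>0"
  proof (rule antisym[OF le])
    have "\<phi> (- x\<^sub>0) \<le> straighten norm x\<^sub>0 (- x\<^sub>0)" using \<phi>(2) by (simp add: le_fun_def)
    also have "\<dots> \<le> - norm x\<^sub>0" using straighten_le[OF n, of 1 x\<^sub>0 "- x\<^sub>0"] by simp
    finally show "norm x\<^sub>0 \<le> \<phi> x\<^sub>0" using neg by simp
  qed
  ultimately show ?thesis by blast
qed

section \<open>Averages of a vector measure\<close>

text \<open>
  The pieces are chosen greedily, each at least half as large as the remainder permits. Their measures
  tend to 0, whereas a piece inside a final remainder of positive measure would have been available at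
  every stage.
\<close>

lemma (in finite_measure) exhaustion:
  assumes \<Omega>: "\<Omega> \<in> sets M" and empty: "P {}"
    and dense: "\<And>E. E \<in> sets M \<Longrightarrow> E \<subseteq> \<Omega> \<Longrightarrow> 0 < measure M E \<Longrightarrow>
      \<exists>F\<in>sets M. F \<subseteq> E \<and> 0 < measure M F \<and> P F"
  shows "\<exists>A::nat \<Rightarrow> 'a set. disjoint_family A \<and>
    (\<forall>i. A i \<in> sets M \<and> A i \<subseteq> \<Omega> \<and> P (A i)) \<and> measure M (\<Omega> - (\<Union>i. A i)) = 0"
proof -
  define S where "S R = measure M ` {F \<in> sets M. F \<subseteq> R \<and> P F}" for R
  have bdd: "bdd_above (S R)" for R
    unfolding S_def by (rule bdd_aboveI2[where M="measure M (space M)"]) (auto intro: bounded_measure)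
  have ex: "\<exists>F. F \<in> sets M \<and> F \<subseteq> R \<and> P F \<and> Sup (S R) \<le> 2 * measure M F" for R
  proof (cases "Sup (S R) \<le> 0")
    case True then show ?thesis using empty by (intro exI[of _ "{}"]) auto
  next
    case False
    have "S R \<noteq> {}" unfolding S_def using empty by blast
    moreover have "Sup (S R) / 2 < Sup (S R)" using False by simp
    ultimately obtain y where "y \<in> S R" "Sup (S R) / 2 < y" using less_cSupE by blast
    then show ?thesis unfolding S_def by force
  qed
  then have "\<forall>R. \<exists>F. F \<in> sets M \<and> F \<subseteq> R \<and> P F \<and> Sup (S R) \<le> 2 * measure M F" by (intro allI)
  from choice[OF this] obtain pick where
    pick: "\<forall>R. pick R \<in> sets M \<and> pick R \<subseteq> R \<and> P (pick R) \<and> Sup (S R) \<le> 2 * measure M (pick R)" ..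
  define R where "R = rec_nat \<Omega> (\<lambda>_ R. R - pick R)"
  have R_0: "R 0 = \<Omega>" and R_Suc: "R (Suc n) = R n - pick (R n)" for n by (simp_all add: R_def)
  define A where "A n = pick (R n)" for n
  have R_anti: "R n \<subseteq> R m" if "m \<le> n" for m n using that by (induction n rule: dec_induct) (auto simp: R_Suc)
  have A: "A n \<in> sets M" "A n \<subseteq> R n" "P (A n)" for n using pick by (auto simp: A_def)
  have A\<Omega>: "A n \<subseteq> \<Omega>" for n using A(2)[of n] R_anti[of 0 n] by (auto simp: R_0)
  have disj: "disjoint_family A"
  proof -
    have "A m \<inter> A n = {}" if "m < n" for m n
    proof -
      have "A n \<subseteq> R (Suc m)" using A(2)[of n] R_anti[of "Suc m" n] that by auto
      then show ?thesis by (auto simp: R_Suc A_def)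
    qed
    then show ?thesis unfolding disjoint_family_on_def by (metis inf_commute nat_neq_iff)
  qed
  have R_rest: "\<Omega> - (\<Union>i. A i) \<subseteq> R n" for n by (induction n) (auto simp: R_0 R_Suc A_def)
  have "measure M (\<Omega> - (\<Union>i. A i)) = 0"
  proof (rule ccontr)
    assume "measure M (\<Omega> - (\<Union>i. A i)) \<noteq> 0"
    then have "0 < measure M (\<Omega> - (\<Union>i. A i))" by (simp add: zero_less_measure_iff)
    moreover have "\<Omega> - (\<Union>i. A i) \<in> sets M" using \<Omega> A(1) by auto
    ultimately obtain F where F: "F \<in> sets M" "F \<subseteq> \<Omega> - (\<Union>i. A i)" "0 < measure M F" "P F"
      using dense[of "\<Omega> - (\<Union>i. A i)"] by blast
    have "measure M F / 2 \<le> measure M (A n)" for n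
    proof -
      have "measure M F \<in> S (R n)" unfolding S_def using F R_rest[of n] by blast
      then have "measure M F \<le> Sup (S (R n))" by (rule cSup_upper[OF _ bdd])
      also have "\<dots> \<le> 2 * measure M (A n)" using pick by (simp add: A_def)
      finally show ?thesis by simp
    qed
    moreover have "(\<lambda>n. measure M (A n)) \<longlonglongrightarrow> 0"
      using finite_measure_UNION[OF _ disj] A(1) by (intro summable_LIMSEQ_zero) (auto simp: sums_iff)
    ultimately have "measure M F / 2 \<le> 0" by (intro LIMSEQ_le_const) auto
    with F(3) show False by simp
  qed
  then show ?thesis using disj A A\<Omega> by blast
qed

locale vector_measure = finite_measure M for M :: "'w measure" +
  fixes \<nu> :: "'w set \<Rightarrow> 'x::banach"
  assumes countably_additive: "vector_measure_on M \<nu>"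
    and bounded_variation: "bounded_variation_on M \<nu>"
    and vanishes: "vanishes_on_null_sets M \<nu>"
begin

text \<open>
  On null sets the average is 0 by the convention for division; products \<open>measure M E * avg E\<close> are right
  all the same, because \<open>\<nu>\<close> vanishes there.
\<close>

definition avg :: "'w set \<Rightarrow> 'x" where
  "avg E = \<nu> E /\<^sub>R measure M E"

lemma nu_null: "E \<in> sets M \<Longrightarrow> measure M E = 0 \<Longrightarrow> \<nu> E = 0"
  using vanishes unfolding vanishes_on_null_sets_def by (simp add: null_sets_def emeasure_eq_measure)

lemma nu_empty [simp]: "\<nu> {} = 0" by (rule nu_null) auto

lemma nu_sums:
  fixes A :: "nat \<Rightarrow> 'w set"
  assumes "\<And>i. A i \<in> sets M" "disjoint_family A"
  shows "(\<lambda>i. \<nu> (A i)) sums \<nu> (\<Union>i. A i)"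
  using countably_additive assms unfolding vector_measure_on_def by blast

lemma nu_Un:
  assumes "A \<in> sets M" "B \<in> sets M" "A \<inter> B = {}"
  shows "\<nu> (A \<union> B) = \<nu> A + \<nu> B"
proof -
  have "(\<lambda>i. \<nu> (binaryset A B i)) sums \<nu> (\<Union>i. binaryset A B i)"
    using assms by (intro nu_sums) (auto simp: binaryset_def disjoint_family_on_def)
  moreover have "(\<lambda>i. \<nu> (binaryset A B i)) sums (\<Sum>i\<in>{0, Suc 0}. \<nu> (binaryset A B i))"
    by (rule sums_finite) (auto simp: binaryset_def)
  ultimately show ?thesis by (auto simp: UN_binaryset_eq binaryset_def dest: sums_unique2)
qed

lemma nu_finite_UN:
  fixes A :: "nat \<Rightarrow> 'w set"
  assumes "\<And>i. A i \<in> sets M" "disjoint_family A"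
  shows "\<nu> (\<Union>i<m. A i) = (\<Sum>i<m. \<nu> (A i))"
proof (induction m)
  case (Suc m)
  have "\<nu> ((\<Union>i<m. A i) \<union> A m) = \<nu> (\<Union>i<m. A i) + \<nu> (A m)"
  proof (rule nu_Un)
    have "A i \<inter> A m = {}" if "i < m" for i using assms(2) that by (simp add: disjoint_family_on_def)
    then show "(\<Union>i<m. A i) \<inter> A m = {}" by blast
  qed (use assms in auto)
  then show ?case using Suc by (simp add: lessThan_Suc Un_commute add.commute)
qed simp

lemma measure_finite_UN:
  fixes A :: "nat \<Rightarrow> 'w set"
  assumes "\<And>i. A i \<in> sets M" "disjoint_family A"
  shows "measure M (\<Union>i<m. A i) = (\<Sum>i<m. measure M (A i))"
  by (rule finite_measure_finite_Union) (use assms in \<open>auto simp: disjoint_family_on_def\<close>)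

text \<open>
  What the sets \<open>A i\<close> miss of \<open>F\<close> lies in the null set that they miss of \<open>E\<close>.
\<close>

lemma sums_exhausting:
  fixes A :: "nat \<Rightarrow> 'w set"
  assumes A: "\<And>i. A i \<in> sets M" "disjoint_family A"
    and E: "E \<in> sets M" and F: "F \<in> sets M" "F \<subseteq> E" and null: "measure M (E - (\<Union>i. A i)) = 0"
  shows "(\<lambda>i. \<nu> (A i \<inter> F)) sums \<nu> F" "(\<lambda>i. measure M (A i \<inter> F)) sums measure M F"
proof -
  let ?U = "\<Union>i. A i \<inter> F"
  have AF: "A i \<inter> F \<in> sets M" for i using A F by auto
  have disj: "disjoint_family (\<lambda>i. A i \<inter> F)" using A(2) by (auto simp: disjoint_family_on_def)
  have U: "?U \<in> sets M" by (rule sets.countable_UN) (use AF in auto)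
  then have U: "?U \<in> sets M" "F - ?U \<in> sets M" using sets.Diff[OF F(1)] by blast+
  have "measure M (F - ?U) \<le> measure M (E - (\<Union>i. A i))"
    using A E F by (intro finite_measure_mono) auto
  then have 0: "measure M (F - ?U) = 0" using null by (simp add: measure_le_0_iff)
  have split: "F = ?U \<union> (F - ?U)" by auto
  have "\<nu> F = \<nu> ?U" using nu_Un[OF U] nu_null[OF U(2) 0] split by (metis Diff_disjoint add.right_neutral)
  then show "(\<lambda>i. \<nu> (A i \<inter> F)) sums \<nu> F" using nu_sums[OF AF disj] by simp
  have "measure M F = measure M ?U"
    using finite_measure_Union[OF U] 0 split by (metis Diff_disjoint add.right_neutral)
  then show "(\<lambda>i. measure M (A i \<inter> F)) sums measure M F"
    using finite_measure_UNION[OF _ disj] AF by auto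
qed

text \<open>
  Finitely many disjoint sets become a partition of the space by adding their complement. Empty members,
  which a partition may not have, contribute nothing.
\<close>

lemma variation_bound:
  "\<exists>K. \<forall>A::nat \<Rightarrow> 'w set. (\<forall>i. A i \<in> sets M) \<longrightarrow> disjoint_family A \<longrightarrow> (\<forall>m. (\<Sum>i<m. norm (\<nu> (A i))) \<le> K)"
proof -
  obtain K where K: "\<And>P. finite P \<Longrightarrow> P \<subseteq> sets M \<Longrightarrow> partition_on (space M) P \<Longrightarrow> (\<Sum>E\<in>P. norm (\<nu> E)) \<le> K"
    using bounded_variation unfolding bounded_variation_on_def by blast
  have "(\<Sum>i<m. norm (\<nu> (A i))) \<le> K" if A: "\<And>i. A i \<in> sets M" "disjoint_family A" for A :: "nat \<Rightarrow> 'w set" and m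
  proof -
    define I where "I = {i. i < m \<and> A i \<noteq> {}}"
    define R where "R = space M - (\<Union>i<m. A i)"
    define P where "P = A ` I \<union> (if R = {} then {} else {R})"
    have [simp]: "finite I" by (simp add: I_def)
    have inj: "inj_on A I" using A(2) by (auto simp: inj_on_def I_def disjoint_family_on_def)
    have "(\<Sum>i<m. norm (\<nu> (A i))) = (\<Sum>i\<in>I. norm (\<nu> (A i)))"
      by (rule sum.mono_neutral_right) (auto simp: I_def)
    also have "\<dots> = (\<Sum>E\<in>A ` I. norm (\<nu> E))" using inj by (simp add: sum.reindex)
    also have "\<dots> \<le> (\<Sum>E\<in>P. norm (\<nu> E))" by (rule sum_mono2) (auto simp: P_def)
    also have "\<dots> \<le> K"
    proof (rule K)
      show "finite P" by (simp add: P_def)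
      show "P \<subseteq> sets M" using A by (auto simp: P_def R_def)
      have sub: "A i \<subseteq> space M" for i using A(1) sets.sets_into_space by blast
      show "partition_on (space M) P"
      proof (rule partition_onI)
        show "\<Union> P = space M"
        proof -
          have "\<Union> P = (\<Union>i\<in>I. A i) \<union> R" by (auto simp: P_def)
          also have "(\<Union>i\<in>I. A i) = (\<Union>i<m. A i)" by (auto simp: I_def)
          finally show ?thesis using sub by (auto simp: R_def)
        qed
        show "{} \<notin> P" by (auto simp: P_def I_def)
        have AA: "disjnt (A i) (A j)" if "A i \<noteq> A j" for i j
        proof -
          have "i \<noteq> j" using that by blast
          then show ?thesis using A(2) by (simp add: disjoint_family_on_def disjnt_def)
        qed
        have AR: "disjnt (A i) R" "disjnt R (A i)" if "i \<in> I" for i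
          using that by (auto simp: R_def I_def disjnt_def)
        show "disjnt p q" if "p \<in> P" "q \<in> P" "p \<noteq> q" for p q
          using that AA AR by (auto simp: P_def split: if_splits)
      qed
    qed
    finally show ?thesis .
  qed
  then show ?thesis by blast
qed

text \<open>
  If subsets with \<open>norm (\<nu> G) \<ge> C * measure M G\<close> could be found everywhere in \<open>E\<close>, they would exhaust it and
  make the variation of \<open>\<nu>\<close> at least \<open>C * measure M E\<close>.
\<close>

lemma locally_bounded:
  assumes E: "E \<in> sets M" "0 < measure M E"
  shows "\<exists>F\<in>sets M. F \<subseteq> E \<and> 0 < measure M F \<and> (\<exists>C. \<forall>G\<in>sets M. G \<subseteq> F \<longrightarrow> norm (\<nu> G) \<le> C * measure M G)"
proof (rule ccontr)
  assume neg: "\<not> ?thesis"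
  obtain K where K: "\<And>A m. (\<And>i::nat. A i \<in> sets M) \<Longrightarrow> disjoint_family A \<Longrightarrow> (\<Sum>i<m. norm (\<nu> (A i))) \<le> K"
    using variation_bound by metis
  \<comment> \<open>so large that \<open>C * measure M E\<close> exceeds the bound \<open>K\<close> on the variation\<close>
  define C where "C = (K + 1) / measure M E"
  have "\<exists>A::nat \<Rightarrow> 'w set. disjoint_family A \<and> (\<forall>i. A i \<in> sets M \<and> A i \<subseteq> E \<and> C * measure M (A i) \<le> norm (\<nu> (A i)))
    \<and> measure M (E - (\<Union>i. A i)) = 0"
  proof (rule exhaustion[OF E(1)])
    fix F assume F: "F \<in> sets M" "F \<subseteq> E" "0 < measure M F"
    obtain G where G: "G \<in> sets M" "G \<subseteq> F" "C * measure M G < norm (\<nu> G)"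
      using neg F by (meson not_le)
    have "measure M G \<noteq> 0" using nu_null[OF G(1)] G(3) by auto
    then show "\<exists>G\<in>sets M. G \<subseteq> F \<and> 0 < measure M G \<and> C * measure M G \<le> norm (\<nu> G)"
      using G by (intro bexI[of _ G]) (auto simp: zero_less_measure_iff)
  qed simp
  then obtain A :: "nat \<Rightarrow> 'w set" where A: "disjoint_family A" "\<And>i. A i \<in> sets M" "\<And>i. A i \<subseteq> E"
      "\<And>i. C * measure M (A i) \<le> norm (\<nu> (A i))" "measure M (E - (\<Union>i. A i)) = 0" by blast
  have "(\<lambda>i. measure M (A i)) sums measure M E"
    using sums_exhausting(2)[OF A(2,1) E(1) E(1) order_refl A(5)] A(3) by (simp add: inf_absorb1)
  then have "(\<lambda>m. \<Sum>i<m. C * measure M (A i)) \<longlonglongrightarrow> C * measure M E"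
    unfolding sums_def[symmetric] by (rule sums_mult)
  moreover have "(\<Sum>i<m. C * measure M (A i)) \<le> K" for m
    using sum_mono[of "{..<m}", OF A(4)] K[OF A(2,1), of m] by (rule order_trans)
  ultimately have "C * measure M E \<le> K" by (intro LIMSEQ_le_const2) auto
  then show False using E(2) by (simp add: C_def)
qed

text \<open>
  Let \<open>s\<close> be the supremum of the averages of the real measure \<open>\<phi> \<circ> \<nu>\<close> over subsets of \<open>E\<close>, and take a subset
  \<open>E1\<close> whose average exceeds \<open>s - \<eta>\<close>. If every part of \<open>E1\<close> contained one with average at most \<open>s - \<eta>\<close>,
  these would exhaust \<open>E1\<close> and its own average would be at most \<open>s - \<eta>\<close>.
\<close>

lemma functional_locally_constant:
  fixes \<phi> :: "'x \<Rightarrow> real"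
  assumes \<phi>: "bounded_linear \<phi>" and E: "E \<in> sets M" "0 < measure M E"
    and C: "\<And>G. G \<in> sets M \<Longrightarrow> G \<subseteq> E \<Longrightarrow> norm (\<nu> G) \<le> C * measure M G" and \<eta>: "0 < \<eta>"
  shows "\<exists>F\<in>sets M. F \<subseteq> E \<and> 0 < measure M F \<and>
    (\<exists>s. \<forall>G\<in>sets M. G \<subseteq> F \<longrightarrow> (s - \<eta>) * measure M G \<le> \<phi> (\<nu> G) \<and> \<phi> (\<nu> G) \<le> s * measure M G)"
proof -
  obtain K where K: "K > 0" "\<And>x. norm (\<phi> x) \<le> norm x * K" using bounded_linear.pos_bounded[OF \<phi>] by blast
  define S where "S = {\<phi> (\<nu> G) / measure M G |G. G \<in> sets M \<and> G \<subseteq> E \<and> 0 < measure M G}"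
  have bdd: "bdd_above S"
  proof (rule bdd_aboveI)
    fix y assume "y \<in> S"
    then obtain G where G: "y = \<phi> (\<nu> G) / measure M G" "G \<in> sets M" "G \<subseteq> E" "0 < measure M G" by (auto simp: S_def)
    have "\<phi> (\<nu> G) \<le> norm (\<nu> G) * K" using K(2)[of "\<nu> G"] by simp
    also have "\<dots> \<le> C * measure M G * K" using C[OF G(2,3)] K(1) by (simp add: mult_right_mono)
    finally have "\<phi> (\<nu> G) \<le> (C * K) * measure M G" by (simp only: mult_ac)
    then show "y \<le> C * K" using G by (simp add: pos_divide_le_eq)
  qed
  have ne: "S \<noteq> {}" using E by (auto simp: S_def)
  define s where "s = Sup S"
  have \<phi>0: "\<phi> 0 = 0" using \<phi> by (simp add: bounded_linear.linear linear_0)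
  have upper: "\<phi> (\<nu> G) \<le> s * measure M G" if G: "G \<in> sets M" "G \<subseteq> E" for G
  proof (cases "measure M G = 0")
    case True then show ?thesis using nu_null[OF G(1)] \<phi>0 by simp
  next
    case False
    then have pos: "0 < measure M G" by (simp add: zero_less_measure_iff)
    then have "\<phi> (\<nu> G) / measure M G \<in> S" using G by (auto simp: S_def)
    then have "\<phi> (\<nu> G) / measure M G \<le> s" unfolding s_def by (rule cSup_upper[OF _ bdd])
    then show ?thesis using pos by (simp add: divide_le_eq)
  qed
  have "s - \<eta> < Sup S" using \<eta> by (simp add: s_def)
  then obtain y where "y \<in> S" "s - \<eta> < y" using less_cSupE ne by blast
  then obtain E1 where E1: "E1 \<in> sets M" "E1 \<subseteq> E" "0 < measure M E1" "s - \<eta> < \<phi> (\<nu> E1) / measure M E1"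
    by (auto simp: S_def)
  have "\<exists>F\<in>sets M. F \<subseteq> E1 \<and> 0 < measure M F \<and> (\<forall>G\<in>sets M. G \<subseteq> F \<longrightarrow> (s - \<eta>) * measure M G \<le> \<phi> (\<nu> G))"
  proof (rule ccontr)
    assume neg: "\<not> ?thesis"
    have "\<exists>A::nat \<Rightarrow> 'w set. disjoint_family A \<and> (\<forall>i. A i \<in> sets M \<and> A i \<subseteq> E1 \<and> \<phi> (\<nu> (A i)) \<le> (s - \<eta>) * measure M (A i))
      \<and> measure M (E1 - (\<Union>i. A i)) = 0"
    proof (rule exhaustion[OF E1(1)])
      show "\<phi> (\<nu> {}) \<le> (s - \<eta>) * measure M {}" by (simp add: \<phi>0)
      fix F assume F: "F \<in> sets M" "F \<subseteq> E1" "0 < measure M F"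
      obtain G where G: "G \<in> sets M" "G \<subseteq> F" "\<phi> (\<nu> G) < (s - \<eta>) * measure M G"
        using neg F by (meson not_le)
      have "measure M G \<noteq> 0" using nu_null[OF G(1)] G(3) \<phi>0 by auto
      then show "\<exists>G\<in>sets M. G \<subseteq> F \<and> 0 < measure M G \<and> \<phi> (\<nu> G) \<le> (s - \<eta>) * measure M G"
        using G by (intro bexI[of _ G]) (auto simp: zero_less_measure_iff)
    qed
    then obtain A :: "nat \<Rightarrow> 'w set" where A: "disjoint_family A" "\<And>i. A i \<in> sets M" "\<And>i. A i \<subseteq> E1"
        "\<And>i. \<phi> (\<nu> (A i)) \<le> (s - \<eta>) * measure M (A i)" "measure M (E1 - (\<Union>i. A i)) = 0" by blast
    have "(\<lambda>i. measure M (A i)) sums measure M E1" "(\<lambda>i. \<nu> (A i)) sums \<nu> E1"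
      using sums_exhausting[OF A(2,1) E1(1) E1(1) order_refl A(5)] A(3) by (simp_all add: inf_absorb1)
    then have "(\<lambda>i. (s - \<eta>) * measure M (A i)) sums ((s - \<eta>) * measure M E1)" "(\<lambda>i. \<phi> (\<nu> (A i))) sums \<phi> (\<nu> E1)"
      by (auto intro: sums_mult bounded_linear.sums[OF \<phi>])
    then have "\<phi> (\<nu> E1) \<le> (s - \<eta>) * measure M E1" using A(4) by (meson sums_le)
    then show False using E1(3,4) by (simp add: less_divide_eq)
  qed
  then show ?thesis using upper E1(2) by (meson order_trans)
qed

text \<open>
  Every subset \<open>E\<close> of \<open>F\<close> of positive measure has a part whose average is at least \<open>\<epsilon> / 2\<close> away from that
  of \<open>F\<close>: if \<open>E\<close> itself is not such a part, then a part of \<open>E\<close> with average \<open>\<epsilon>\<close> away from that of \<open>E\<close> is.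
  Such parts exhaust \<open>F\<close>, and finitely many of them fill more than half of it. The remainder serves to
  complete the average.
\<close>

lemma oscillating_split:
  assumes F: "F \<in> sets M" "0 < measure M F"
    and osc: "\<And>E. E \<in> sets M \<Longrightarrow> E \<subseteq> F \<Longrightarrow> 0 < measure M E \<Longrightarrow>
      \<exists>G\<in>sets M. G \<subseteq> E \<and> \<epsilon> * measure M G < norm (\<nu> G - measure M G *\<^sub>R avg E)"
    and \<epsilon>: "0 < \<epsilon>"
  shows "\<exists>m (G::nat \<Rightarrow> 'w set). (\<forall>i. G i \<in> sets M \<and> G i \<subseteq> F) \<and> (\<Sum>i<m. \<nu> (G i)) = \<nu> F \<and>
    (\<Sum>i<m. measure M (G i)) = measure M F \<and>
    \<epsilon> / 4 * measure M F \<le> (\<Sum>i<m. norm (\<nu> (G i) - measure M (G i) *\<^sub>R avg F))"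
proof -
  let ?far = "\<lambda>G. \<epsilon> / 2 * measure M G \<le> norm (\<nu> G - measure M G *\<^sub>R avg F)"
  have "\<exists>A::nat \<Rightarrow> 'w set. disjoint_family A \<and> (\<forall>i. A i \<in> sets M \<and> A i \<subseteq> F \<and> ?far (A i))
    \<and> measure M (F - (\<Union>i. A i)) = 0"
  proof (rule exhaustion[OF F(1)])
    fix E assume E: "E \<in> sets M" "E \<subseteq> F" "0 < measure M E"
    show "\<exists>G\<in>sets M. G \<subseteq> E \<and> 0 < measure M G \<and> ?far G"
    proof (cases "?far E")
      case True then show ?thesis using E by blast
    next
      case False
      have "\<nu> E - measure M E *\<^sub>R avg F = measure M E *\<^sub>R (avg E - avg F)"
        using E(3) by (simp add: avg_def scaleR_diff_right)
      with False E(3) have near: "norm (avg E - avg F) < \<epsilon> / 2"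
        by (simp add: mult.commute)
      obtain G where G: "G \<in> sets M" "G \<subseteq> E" "\<epsilon> * measure M G < norm (\<nu> G - measure M G *\<^sub>R avg E)"
        using osc[OF E] by blast
      have "measure M G \<noteq> 0" using nu_null[OF G(1)] G(3) by auto
      then have pos: "0 < measure M G" by (simp add: zero_less_measure_iff)
      have "\<nu> G - measure M G *\<^sub>R avg E = (\<nu> G - measure M G *\<^sub>R avg F) - measure M G *\<^sub>R (avg E - avg F)"
        by (simp add: algebra_simps)
      then have "norm (\<nu> G - measure M G *\<^sub>R avg E)
          \<le> norm (\<nu> G - measure M G *\<^sub>R avg F) + measure M G * norm (avg E - avg F)"
        using norm_triangle_ineq4[of "\<nu> G - measure M G *\<^sub>R avg F" "measure M G *\<^sub>R (avg E - avg F)"]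
        by (simp only: norm_scaleR abs_of_pos[OF pos])
      moreover have "measure M G * norm (avg E - avg F) \<le> measure M G * (\<epsilon> / 2)"
        using near by (intro mult_left_mono) auto
      moreover have "\<epsilon> * measure M G = \<epsilon> / 2 * measure M G + measure M G * (\<epsilon> / 2)" by (simp add: field_simps)
      ultimately have "?far G" using G(3) by linarith
      then show ?thesis using G pos by blast
    qed
  qed simp
  then obtain A :: "nat \<Rightarrow> 'w set" where A: "disjoint_family A" "\<And>i. A i \<in> sets M" "\<And>i. A i \<subseteq> F"
      "\<And>i. ?far (A i)" "measure M (F - (\<Union>i. A i)) = 0" by blast
  have "(\<lambda>i. measure M (A i)) sums measure M F"
    using sums_exhausting(2)[OF A(2,1) F(1) F(1) order_refl A(5)] A(3) by (simp add: inf_absorb1)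
  \<comment> \<open>the finitely many far pieces kept fill half of \<open>F\<close>, which costs one of the two factors 2 in \<open>\<epsilon> / 4\<close>\<close>
  then have "\<forall>\<^sub>F m in sequentially. measure M F / 2 < (\<Sum>i<m. measure M (A i))"
    unfolding sums_def by (rule order_tendstoD) (use F(2) in simp)
  then obtain m where m: "measure M F / 2 < (\<Sum>i<m. measure M (A i))"
    by (auto simp: eventually_sequentially)
  define R where "R = F - (\<Union>i<m. A i)"
  define G where "G i = (if i < m then A i else R)" for i
  have R: "R \<in> sets M" "(\<Union>i<m. A i) \<in> sets M" "(\<Union>i<m. A i) \<inter> R = {}" "F = (\<Union>i<m. A i) \<union> R"
    using A F by (auto simp: R_def)
  have "\<nu> F = (\<Sum>i<m. \<nu> (A i)) + \<nu> R"
    using nu_Un[OF R(2,1,3)] nu_finite_UN[OF A(2,1)] R(4) by metis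
  moreover have "measure M F = (\<Sum>i<m. measure M (A i)) + measure M R"
    using finite_measure_Union[OF R(2,1,3)] measure_finite_UN[OF A(2,1)] R(4) by metis
  moreover have "\<epsilon> / 4 * measure M F \<le> (\<Sum>i<Suc m. norm (\<nu> (G i) - measure M (G i) *\<^sub>R avg F))"
  proof -
    have "\<epsilon> / 4 * measure M F = \<epsilon> / 2 * (measure M F / 2)" by simp
    also have "\<dots> \<le> \<epsilon> / 2 * (\<Sum>i<m. measure M (A i))" using m \<epsilon> by (intro mult_left_mono) auto
    also have "\<dots> \<le> (\<Sum>i<m. norm (\<nu> (A i) - measure M (A i) *\<^sub>R avg F))"
      unfolding sum_distrib_left by (rule sum_mono) (rule A(4))
    also have "\<dots> = (\<Sum>i<m. norm (\<nu> (G i) - measure M (G i) *\<^sub>R avg F))" by (simp add: G_def)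
    finally show ?thesis by (simp add: add_increasing2)
  qed
  ultimately show ?thesis using A(2,3) R(1)
    by (intro exI[of _ "Suc m"] exI[of _ G]) (auto simp: G_def R_def)
qed

end

section \<open>A density from locally constant averages\<close>

lemma (in finite_measure) simple_bochner_integral_sum_indicators:
  fixes c :: "nat \<Rightarrow> 'x::real_normed_vector"
  assumes B: "\<And>i. B i \<in> sets M"
  shows "Bochner_Integration.simple_bochner_integrable M (\<lambda>w. \<Sum>i<n. indicator (B i) w *\<^sub>R c i)"
    and "Bochner_Integration.simple_bochner_integral M (\<lambda>w. \<Sum>i<n. indicator (B i) w *\<^sub>R c i)
      = (\<Sum>i<n. measure M (B i) *\<^sub>R c i)"
proof -
  have one: "Bochner_Integration.simple_bochner_integrable M (indicator (B i) :: 'a \<Rightarrow> real)" for i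
    using B by (intro simple_bochner_integrable.intros) (auto simp: emeasure_eq_measure)
  have one': "Bochner_Integration.simple_bochner_integrable M (\<lambda>w. indicator (B i) w *\<^sub>R c i)" for i
    by (rule simple_bochner_integrable_compose2[where p="\<lambda>r _. r *\<^sub>R c i", OF _ one one]) simp
  have "Bochner_Integration.simple_bochner_integral M (indicator (B i) :: 'a \<Rightarrow> real) = measure M (B i)" for i
    using has_bochner_integral_simple_bochner_integrable[OF one, of i] has_bochner_integral_real_indicator[OF B, of i]
    by (intro has_bochner_integral_eq) (auto simp: emeasure_eq_measure)
  then have val: "Bochner_Integration.simple_bochner_integral M (\<lambda>w. indicator (B i) w *\<^sub>R c i) = measure M (B i) *\<^sub>R c i" for i
    using simple_bochner_integral_linear[OF _ one, of "\<lambda>r. r *\<^sub>R c i" i]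
    by (simp add: bounded_linear.linear bounded_linear_scaleR_left)
  have int: "Bochner_Integration.simple_bochner_integrable M (\<lambda>w. \<Sum>i<n. indicator (B i) w *\<^sub>R c i)" for n
  proof (induction n)
    case 0
    show ?case by (intro simple_bochner_integrable.intros) auto
  next
    case (Suc n)
    from simple_bochner_integrable_compose2[where p="(+)", OF _ Suc one'] show ?case by simp
  qed
  then show "Bochner_Integration.simple_bochner_integrable M (\<lambda>w. \<Sum>i<n. indicator (B i) w *\<^sub>R c i)" .
  show "Bochner_Integration.simple_bochner_integral M (\<lambda>w. \<Sum>i<n. indicator (B i) w *\<^sub>R c i)
      = (\<Sum>i<n. measure M (B i) *\<^sub>R c i)"
  proof (induction n)
    case 0
    show ?case by (auto simp: simple_bochner_integral_def intro!: sum.neutral)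
  next
    case (Suc n)
    from simple_bochner_integral_add[OF int one'] Suc val show ?case by simp
  qed
qed

context vector_measure
begin

text \<open>
  The condition on the average over \<open>G\<close> is multiplied by \<open>measure M G\<close>, so that null sets are no exception.
\<close>

definition flat :: "real \<Rightarrow> 'w set \<Rightarrow> bool" where
  "flat \<epsilon> F \<longleftrightarrow> (\<forall>G\<in>sets M. G \<subseteq> F \<longrightarrow> norm (\<nu> G - measure M G *\<^sub>R avg F) \<le> \<epsilon> * measure M G)"

text \<open>
  The index \<open>N\<close> cuts off a tail that is small both in measure and in variation, so that step functions on
  the partition can be truncated to simple functions.
\<close>

lemma flat_partition:
  assumes dense: "\<And>E. E \<in> sets M \<Longrightarrow> 0 < measure M E \<Longrightarrow> \<exists>F\<in>sets M. F \<subseteq> E \<and> 0 < measure M F \<and> flat \<epsilon> F"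
    and \<epsilon>: "0 < \<epsilon>"
  shows "\<exists>(A::nat \<Rightarrow> 'w set) N. disjoint_family A \<and> (\<forall>i. A i \<in> sets M) \<and> (\<forall>i. flat \<epsilon> (A i)) \<and>
    measure M (space M - (\<Union>i. A i)) = 0 \<and> measure M (space M - (\<Union>i<N. A i)) \<le> \<epsilon> \<and>
    summable (\<lambda>i. norm (\<nu> (A i))) \<and> (\<Sum>i. norm (\<nu> (A (i + N)))) \<le> \<epsilon>"
proof -
  have "\<exists>A::nat \<Rightarrow> 'w set. disjoint_family A \<and> (\<forall>i. A i \<in> sets M \<and> A i \<subseteq> space M \<and> flat \<epsilon> (A i))
    \<and> measure M (space M - (\<Union>i. A i)) = 0"
    by (rule exhaustion[OF sets.top]) (use dense in \<open>auto simp: flat_def\<close>)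
  then obtain A :: "nat \<Rightarrow> 'w set" where A: "disjoint_family A" "\<And>i. A i \<in> sets M"
      "\<And>i. flat \<epsilon> (A i)" "measure M (space M - (\<Union>i. A i)) = 0" by blast
  obtain K where K: "\<And>m. (\<Sum>i<m. norm (\<nu> (A i))) \<le> K" using variation_bound A(1,2) by blast
  have sum\<nu>: "summable (\<lambda>i. norm (\<nu> (A i)))" by (rule summableI_nonneg_bounded[OF _ K]) simp
  have Asp: "A i \<inter> space M = A i" for i using sets.sets_into_space[OF A(2)] by blast
  have sums\<mu>: "(\<lambda>i. measure M (A i)) sums measure M (space M)"
    using sums_exhausting(2)[OF A(2,1) sets.top sets.top order_refl A(4)] by (simp only: Asp)
  have "summable (\<lambda>i. measure M (A i))" using sums\<mu> by (rule sums_summable)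
  from suminf_exist_split[OF \<epsilon> sum\<nu>] obtain N1 where N1: "\<And>n. N1 \<le> n \<Longrightarrow> norm (\<Sum>i. norm (\<nu> (A (i + n)))) < \<epsilon>" by blast
  from suminf_exist_split[OF \<epsilon> \<open>summable (\<lambda>i. measure M (A i))\<close>]
  obtain N2 where N2: "\<And>n. N2 \<le> n \<Longrightarrow> norm (\<Sum>i. measure M (A (i + n))) < \<epsilon>" by blast
  define N where "N = max N1 N2"
  have U: "(\<Union>i<N. A i) \<in> sets M" using A(2) by auto
  have "measure M (space M - (\<Union>i<N. A i)) = measure M (space M) - (\<Sum>i<N. measure M (A i))"
    using finite_measure_compl[OF U] measure_finite_UN[OF A(2,1)] by simp
  also have "\<dots> = (\<Sum>i. measure M (A (i + N)))"
    using suminf_split_initial_segment[OF \<open>summable (\<lambda>i. measure M (A i))\<close>, of N] sums_unique[OF sums\<mu>] by simp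
  also have "\<dots> \<le> \<epsilon>" using N2[of N] by (simp add: N_def)
  finally have "measure M (space M - (\<Union>i<N. A i)) \<le> \<epsilon>" .
  moreover have "(\<Sum>i. norm (\<nu> (A (i + N)))) \<le> \<epsilon>" using N1[of N] by (simp add: N_def)
  ultimately show ?thesis using A sum\<nu> by blast
qed

text \<open>
  Both averages are close to the one over the common part.
\<close>

lemma flat_close:
  assumes "flat \<epsilon> F" "flat \<epsilon>' F'" "F \<in> sets M" "F' \<in> sets M" "0 < measure M (F \<inter> F')"
  shows "norm (avg F - avg F') \<le> \<epsilon> + \<epsilon>'"
proof -
  let ?G = "F \<inter> F'"
  have G: "?G \<in> sets M" using assms by auto
  have "norm (\<nu> ?G - measure M ?G *\<^sub>R avg F) \<le> \<epsilon> * measure M ?G"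
       "norm (\<nu> ?G - measure M ?G *\<^sub>R avg F') \<le> \<epsilon>' * measure M ?G"
    using assms G unfolding flat_def by auto
  then have "norm ((\<nu> ?G - measure M ?G *\<^sub>R avg F') - (\<nu> ?G - measure M ?G *\<^sub>R avg F)) \<le> \<epsilon>' * measure M ?G + \<epsilon> * measure M ?G"
    by (meson add_mono norm_triangle_ineq4 order_trans)
  moreover have "(\<nu> ?G - measure M ?G *\<^sub>R avg F') - (\<nu> ?G - measure M ?G *\<^sub>R avg F) = measure M ?G *\<^sub>R (avg F - avg F')"
    by (simp add: scaleR_diff_right)
  ultimately have "measure M ?G * norm (avg F - avg F') \<le> measure M ?G * (\<epsilon> + \<epsilon>')"
    by (simp only: norm_scaleR abs_of_pos[OF assms(5)]) (simp add: algebra_simps)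
  then show ?thesis using assms(5) by simp
qed

text \<open>
  For \<open>\<epsilon> = (1/2) ^ k\<close> partition the space into flat sets and let the \<open>k\<close>-th step function take on each of
  them its average. On a point outside countably many null sets two step functions differ by at most the
  sum of their \<open>\<epsilon>\<close>, so they converge uniformly to some \<open>f\<close>. Flatness says that integrating the \<open>k\<close>-th step
  function over \<open>E\<close> gives \<open>\<nu> E\<close> up to \<open>(1/2) ^ k * measure M E\<close>, and truncating the step functions to
  finitely many pieces costs an error that also tends to 0.
\<close>

lemma density_exists:
  assumes dense: "\<And>\<epsilon> E. 0 < \<epsilon> \<Longrightarrow> E \<in> sets M \<Longrightarrow> 0 < measure M E \<Longrightarrow> \<exists>F\<in>sets M. F \<subseteq> E \<and> 0 < measure M F \<and> flat \<epsilon> F"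
  shows "\<exists>f. \<forall>E\<in>sets M. has_strong_bochner_integral M (\<lambda>w. indicator E w *\<^sub>R f w) (\<nu> E)"
proof -
  define e :: "nat \<Rightarrow> real" where "e k = (1/2) ^ k" for k
  have e: "0 < e k" for k by (simp add: e_def)
  have e0: "e \<longlonglongrightarrow> 0" unfolding e_def by (rule LIMSEQ_realpow_zero) auto
  have "\<forall>k. \<exists>p::(nat \<Rightarrow> 'w set) \<times> nat. disjoint_family (fst p) \<and> (\<forall>i. fst p i \<in> sets M) \<and> (\<forall>i. flat (e k) (fst p i)) \<and>
    measure M (space M - (\<Union>i. fst p i)) = 0 \<and> measure M (space M - (\<Union>i<snd p. fst p i)) \<le> e k \<and>
    summable (\<lambda>i. norm (\<nu> (fst p i))) \<and> (\<Sum>i. norm (\<nu> (fst p (i + snd p)))) \<le> e k"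
    using flat_partition[OF dense[OF e] e] by (intro allI) simp
  from choice[OF this] obtain p :: "nat \<Rightarrow> (nat \<Rightarrow> 'w set) \<times> nat" where
    p: "\<forall>k. disjoint_family (fst (p k)) \<and> (\<forall>i. fst (p k) i \<in> sets M) \<and> (\<forall>i. flat (e k) (fst (p k) i)) \<and>
    measure M (space M - (\<Union>i. fst (p k) i)) = 0 \<and> measure M (space M - (\<Union>i<snd (p k). fst (p k) i)) \<le> e k \<and>
    summable (\<lambda>i. norm (\<nu> (fst (p k) i))) \<and> (\<Sum>i. norm (\<nu> (fst (p k) (i + snd (p k))))) \<le> e k" ..
  define A where "A k = fst (p k)" for k
  define N where "N k = snd (p k)" for k
  have A: "disjoint_family (A k)" "A k i \<in> sets M" "flat (e k) (A k i)" "measure M (space M - (\<Union>i. A k i)) = 0"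
    "measure M (space M - (\<Union>i<N k. A k i)) \<le> e k" "summable (\<lambda>i. norm (\<nu> (A k i)))"
    "(\<Sum>i. norm (\<nu> (A k (i + N k)))) \<le> e k" for k i
    using p by (simp_all add: A_def N_def)
  define a where "a k i = avg (A k i)" for k i
  define s where "s k w = (\<Sum>i<N k. indicator (A k i) w *\<^sub>R a k i)" for k w
  have disj: "i = j" if "w \<in> A k i" "w \<in> A k j" for w k i j
    using A(1)[of k] that unfolding disjoint_family_on_def by blast
  have s_eq: "s k w = (if i < N k then a k i else 0)" if w: "w \<in> A k i" for k w i
  proof -
    have "indicator (A k j) w *\<^sub>R a k j = (if j = i then a k i else 0)" for j
    proof (cases "j = i")
      case False
      then have "w \<notin> A k j" using disj[OF w] by blast
      then show ?thesis using False by simp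
    qed (use w in simp)
    then have "s k w = (\<Sum>j<N k. if j = i then a k i else 0)" unfolding s_def by (intro sum.cong) auto
    then show ?thesis by simp
  qed
  have \<nu>_a: "measure M (A k i) * norm (a k i) \<le> norm (\<nu> (A k i))" for k i
    by (cases "measure M (A k i) = 0") (auto simp: a_def avg_def mult.assoc[symmetric])

  have shift: "summable (\<lambda>i. norm (\<nu> (A k (i + N k))))" for k
    using summable_ignore_initial_segment[OF A(6)[of k]] .

  \<comment> \<open>the last of the next three facts is Borel-Cantelli: the cut-off tails have summable measures\<close>
  have AE1: "AE w in M. \<forall>k. \<exists>i. w \<in> A k i"
  proof (subst AE_all_countable, intro allI)
    fix k
    have "space M - (\<Union>i. A k i) \<in> null_sets M"
      using A(2,4) by (auto simp: null_sets_def emeasure_eq_measure)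
    then show "AE w in M. \<exists>i. w \<in> A k i" by (rule AE_I') auto
  qed
  have AE2: "AE w in M. \<forall>k l i j. w \<in> A k i \<inter> A l j \<longrightarrow> 0 < measure M (A k i \<inter> A l j)"
  proof (subst AE_all_countable, intro allI, subst AE_all_countable, intro allI, subst AE_all_countable, intro allI,
      subst AE_all_countable, intro allI)
    fix k l i j
    show "AE w in M. w \<in> A k i \<inter> A l j \<longrightarrow> 0 < measure M (A k i \<inter> A l j)"
    proof (cases "measure M (A k i \<inter> A l j) = 0")
      case True
      have "A k i \<inter> A l j \<in> null_sets M"
        using A(2)[of k i] A(2)[of l j] True by (auto simp: null_sets_def emeasure_eq_measure)
      then show ?thesis by (rule AE_I') auto
    qed (simp add: zero_less_measure_iff)
  qed
  have AE3: "AE w in M. \<forall>\<^sub>F k in sequentially. w \<in> space M - (space M - (\<Union>i<N k. A k i))"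
  proof (rule borel_cantelli_AE1)
    show "space M - (\<Union>i<N k. A k i) \<in> sets M" for k using A(2) by auto
    show "emeasure M (space M - (\<Union>i<N k. A k i)) < \<infinity>" for k by (simp add: emeasure_eq_measure)
    have "summable e" unfolding e_def by (rule summable_geometric) simp
    then show "summable (\<lambda>k. measure M (space M - (\<Union>i<N k. A k i)))"
      by (rule summable_comparison_test'[where N=0]) (use A(5) in auto)
  qed

  define good where "good w \<longleftrightarrow> (\<forall>k. \<exists>i. w \<in> A k i) \<and>
    (\<forall>k l i j. w \<in> A k i \<inter> A l j \<longrightarrow> 0 < measure M (A k i \<inter> A l j)) \<and>
    (\<forall>\<^sub>F k in sequentially. w \<in> (\<Union>i<N k. A k i))" for w
  have AE_good: "AE w in M. good w"
    using AE1 AE2 AE3 AE_space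
  proof eventually_elim
    case (elim w)
    have "\<forall>\<^sub>F k in sequentially. w \<in> (\<Union>i<N k. A k i)" using elim(3) by (rule eventually_mono) (use elim(4) in auto)
    then show ?case using elim unfolding good_def by blast
  qed

  define ix where "ix k w = (SOME i. w \<in> A k i)" for k w
  define f where "f w = lim (\<lambda>k. a k (ix k w))" for w
  have ix: "w \<in> A k (ix k w)" if "good w" for k w
    using that unfolding good_def ix_def by (metis someI_ex)
  have close: "norm (a k (ix k w) - a l (ix l w)) \<le> e k + e l" if "good w" for k l w
    unfolding a_def
    using that ix[OF that] by (intro flat_close A) (auto simp: good_def)
  have lim: "(\<lambda>k. a k (ix k w)) \<longlonglongrightarrow> f w" if w: "good w" for w
  proof -
    have "Cauchy (\<lambda>k. a k (ix k w))"
    proof (rule CauchyI)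
      fix r :: real assume r: "0 < r"
      have "\<forall>\<^sub>F k in sequentially. e k < r / 2" using e0 by (rule order_tendstoD) (use r in simp)
      then obtain K where "\<And>k. K \<le> k \<Longrightarrow> e k < r / 2" by (auto simp: eventually_sequentially)
      then show "\<exists>K. \<forall>m\<ge>K. \<forall>n\<ge>K. norm (a m (ix m w) - a n (ix n w)) < r"
        using close[OF w] by (intro exI[of _ K]) (smt (verit) field_sum_of_halves)
    qed
    then show ?thesis unfolding f_def by (simp add: Cauchy_convergent_iff convergent_LIMSEQ_iff)
  qed
  have f_close: "norm (f w - a k (ix k w)) \<le> e k" if w: "good w" for k w
  proof (rule tendsto_le[OF _ _ _ always_eventually])
    show "(\<lambda>l. norm (a l (ix l w) - a k (ix k w))) \<longlonglongrightarrow> norm (f w - a k (ix k w))"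
      by (intro tendsto_intros lim[OF w])
    show "(\<lambda>l. e l + e k) \<longlonglongrightarrow> e k" using tendsto_add[OF e0 tendsto_const[of "e k"]] by simp
    show "\<forall>l. norm (a l (ix l w) - a k (ix k w)) \<le> e l + e k" using close[OF w] by blast
  qed simp
  have s_lim: "(\<lambda>k. s k w) \<longlonglongrightarrow> f w" if w: "good w" for w
  proof (rule Lim_transform_eventually[OF lim[OF w]])
    have "\<forall>\<^sub>F k in sequentially. w \<in> (\<Union>i<N k. A k i)" using w by (simp add: good_def)
    then show "\<forall>\<^sub>F k in sequentially. a k (ix k w) = s k w"
    proof (rule eventually_mono)
      fix k assume "w \<in> (\<Union>i<N k. A k i)"
      then obtain i where "i < N k" "w \<in> A k i" by blast
      then show "a k (ix k w) = s k w" using s_eq[of w k i] disj[OF ix[OF w, of k], of i] by simp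
    qed
  qed

  \<comment> \<open>the values lost by truncation; their integral is at most the variation over the tail\<close>
  define u where "u k w = (\<Sum>i. ennreal (norm (a k (i + N k))) * indicator (A k (i + N k)) w)" for k w
  have bound: "ennreal (norm (f w - s k w)) \<le> ennreal (e k) + u k w" if w: "good w" for k w
  proof (cases "ix k w < N k")
    case True
    then have "s k w = a k (ix k w)" using s_eq[OF ix[OF w, of k]] by simp
    then have "ennreal (norm (f w - s k w)) \<le> ennreal (e k)" using f_close[OF w, of k] by (simp add: ennreal_leI)
    then show ?thesis by (simp add: add_increasing2)
  next
    case False
    then have "s k w = 0" using s_eq[OF ix[OF w, of k]] by simp
    moreover have "norm (f w) \<le> e k + norm (a k (ix k w))"
      using f_close[OF w, of k] norm_triangle_ineq2[of "f w" "a k (ix k w)"] by linarith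
    ultimately have "ennreal (norm (f w - s k w)) \<le> ennreal (e k + norm (a k (ix k w)))"
      by (simp add: ennreal_leI)
    also have "\<dots> = ennreal (e k) + ennreal (norm (a k (ix k w)))"
      by (rule ennreal_plus) (use e[of k] in auto)
    also have "ennreal (norm (a k (ix k w))) \<le> u k w"
    proof -
      obtain j where j: "ix k w = j + N k" using False by (metis add.commute le_Suc_ex not_less)
      have "ennreal (norm (a k (ix k w))) = (\<Sum>i\<in>{j}. ennreal (norm (a k (i + N k))) * indicator (A k (i + N k)) w)"
        using ix[OF w, of k] j by simp
      also have "\<dots> \<le> u k w" unfolding u_def by (rule sum_le_suminf) auto
      finally show ?thesis .
    qed
    finally show ?thesis by (simp add: add_left_mono)
  qed
  have int_u: "(\<integral>\<^sup>+w. u k w \<partial>M) \<le> ennreal (e k)" for k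
  proof -
    have "(\<integral>\<^sup>+w. u k w \<partial>M) = (\<Sum>i. \<integral>\<^sup>+w. ennreal (norm (a k (i + N k))) * indicator (A k (i + N k)) w \<partial>M)"
      unfolding u_def using A(2) by (intro nn_integral_suminf) auto
    also have "\<dots> = (\<Sum>i. ennreal (norm (a k (i + N k)) * measure M (A k (i + N k))))"
      using A(2) by (simp add: nn_integral_cmult_indicator emeasure_eq_measure ennreal_mult)
    also have "\<dots> \<le> (\<Sum>i. ennreal (norm (\<nu> (A k (i + N k)))))"
      using \<nu>_a by (intro suminf_le ennreal_leI) (auto simp: mult.commute)
    also have "\<dots> = ennreal (\<Sum>i. norm (\<nu> (A k (i + N k))))"
      using shift[of k] by (intro suminf_ennreal2) auto
    also have "\<dots> \<le> ennreal (e k)" by (intro ennreal_leI A(7))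
    finally show ?thesis .
  qed
  have int_s: "(\<integral>\<^sup>+w. ennreal (norm (f w - s k w)) \<partial>M) \<le> ennreal ((measure M (space M) + 1) * e k)" for k
  proof -
    have "(\<integral>\<^sup>+w. ennreal (norm (f w - s k w)) \<partial>M) \<le> (\<integral>\<^sup>+w. ennreal (e k) + u k w \<partial>M)"
      using AE_good by (intro nn_integral_mono_AE) (auto elim!: eventually_mono intro: bound)
    also have "\<dots> = (\<integral>\<^sup>+w. ennreal (e k) \<partial>M) + (\<integral>\<^sup>+w. u k w \<partial>M)"
      unfolding u_def using A(2) by (intro nn_integral_add) auto
    also have "\<dots> \<le> ennreal (e k * measure M (space M)) + ennreal (e k)"
      using int_u[of k] e[of k] by (intro add_mono) (auto simp: emeasure_eq_measure ennreal_mult)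
    also have "\<dots> = ennreal ((measure M (space M) + 1) * e k)"
    proof -
      have "(measure M (space M) + 1) * e k = e k * measure M (space M) + e k" by (simp add: algebra_simps)
      then show ?thesis using ennreal_plus[of "e k * measure M (space M)" "e k"] e[of k] by (metis less_imp_le measure_nonneg mult_nonneg_nonneg)
    qed
    finally show ?thesis .
  qed

  show ?thesis
  proof (intro exI[of _ f] ballI)
    fix E assume E: "E \<in> sets M"
    define S where "S k w = (\<Sum>i<N k. indicator (A k i \<inter> E) w *\<^sub>R a k i)" for k w
    have AE_sets: "A k i \<inter> E \<in> sets M" for k i using A(2) E by auto
    have S_eq: "S k w = indicator E w *\<^sub>R s k w" for k w
      unfolding S_def s_def scaleR_sum_right by (intro sum.cong) (auto simp: indicator_def)
    have S_int: "Bochner_Integration.simple_bochner_integrable M (S k)"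
      and S_val: "Bochner_Integration.simple_bochner_integral M (S k) = (\<Sum>i<N k. measure M (A k i \<inter> E) *\<^sub>R a k i)" for k
      unfolding S_def
      using simple_bochner_integral_sum_indicators[where B="\<lambda>i. A k i \<inter> E" and c="a k" and n="N k", OF AE_sets] by simp_all
    have "strongly_measurable M (\<lambda>w. indicator E w *\<^sub>R f w)"
      unfolding strongly_measurable_def
    proof (intro exI[of _ S] conjI allI)
      show "simple_function M (S k)" for k using S_int[of k] by (simp add: simple_bochner_integrable.simps)
      show "AE w in M. (\<lambda>k. S k w) \<longlonglongrightarrow> indicator E w *\<^sub>R f w"
        using AE_good by eventually_elim (simp add: S_eq tendsto_scaleR s_lim)
    qed
    moreover have "(\<lambda>k. \<integral>\<^sup>+ w. ennreal (norm (indicator E w *\<^sub>R f w - S k w)) \<partial>M) \<longlonglongrightarrow> 0"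
    proof (rule tendsto_sandwich[OF always_eventually always_eventually tendsto_const])
      show "\<forall>k. (\<integral>\<^sup>+ w. ennreal (norm (indicator E w *\<^sub>R f w - S k w)) \<partial>M) \<le> ennreal ((measure M (space M) + 1) * e k)"
      proof
        fix k
        have "(\<integral>\<^sup>+ w. ennreal (norm (indicator E w *\<^sub>R f w - S k w)) \<partial>M) \<le> (\<integral>\<^sup>+w. ennreal (norm (f w - s k w)) \<partial>M)"
          by (intro nn_integral_mono) (auto simp: S_eq indicator_def)
        then show "(\<integral>\<^sup>+ w. ennreal (norm (indicator E w *\<^sub>R f w - S k w)) \<partial>M) \<le> ennreal ((measure M (space M) + 1) * e k)"
          using int_s[of k] by (rule order_trans)
      qed
      have "(\<lambda>k. ennreal ((measure M (space M) + 1) * e k)) \<longlonglongrightarrow> ennreal ((measure M (space M) + 1) * 0)"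
        by (intro tendsto_ennrealI tendsto_intros e0)
      then show "(\<lambda>k. ennreal ((measure M (space M) + 1) * e k)) \<longlonglongrightarrow> 0" by simp
    qed simp
    moreover have "(\<lambda>k. Bochner_Integration.simple_bochner_integral M (S k)) \<longlonglongrightarrow> \<nu> E"
    proof (rule LIM_zero_cancel, rule Lim_null_comparison[OF always_eventually])
      show "\<forall>k. norm (Bochner_Integration.simple_bochner_integral M (S k) - \<nu> E) \<le> (measure M (space M) + 1) * e k"
      proof
        fix k
        let ?I = "\<lambda>m. \<Sum>i<m. measure M (A k i \<inter> E) *\<^sub>R a k i"
        have AEk: "(\<lambda>i. \<nu> (A k i \<inter> E)) sums \<nu> E" "(\<lambda>i. measure M (A k i \<inter> E)) sums measure M E"
          using sums_exhausting[OF A(2) A(1) sets.top E sets.sets_into_space[OF E] A(4)[of k]] by auto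
        \<comment> \<open>compare with a longer partial sum, for which \<open>tail\<close> bounds the added terms and \<open>head\<close> uses flatness\<close>
        have "norm (?I (N k) - (\<Sum>i<m. \<nu> (A k i \<inter> E))) \<le> (measure M (space M) + 1) * e k" if m: "N k \<le> m" for m
        proof -
          have "?I m - ?I (N k) = (\<Sum>i\<in>{N k..<m}. measure M (A k i \<inter> E) *\<^sub>R a k i)"
            using m by (simp add: sum_diff_nat_ivl flip: atLeast0LessThan)
          also have "norm \<dots> \<le> (\<Sum>i\<in>{N k..<m}. norm (\<nu> (A k i)))"
          proof (rule order_trans[OF norm_sum sum_mono])
            fix i
            have "norm (measure M (A k i \<inter> E) *\<^sub>R a k i) \<le> measure M (A k i) * norm (a k i)"
              using A(2)[of k i] by (auto intro!: mult_right_mono finite_measure_mono)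
            then show "norm (measure M (A k i \<inter> E) *\<^sub>R a k i) \<le> norm (\<nu> (A k i))" using \<nu>_a[of k i] by linarith
          qed
          also have "\<dots> = (\<Sum>i<m - N k. norm (\<nu> (A k (i + N k))))"
            using m sum.shift_bounds_nat_ivl[of "\<lambda>i. norm (\<nu> (A k i))" 0 "N k" "m - N k"] by (simp add: atLeast0LessThan)
          also have "\<dots> \<le> (\<Sum>i. norm (\<nu> (A k (i + N k))))"
            using shift[of k] by (intro sum_le_suminf) auto
          also have "\<dots> \<le> e k" by (rule A(7))
          finally have tail: "norm (?I m - ?I (N k)) \<le> e k" .
          have "norm ((\<Sum>i<m. \<nu> (A k i \<inter> E)) - ?I m) = norm (\<Sum>i<m. \<nu> (A k i \<inter> E) - measure M (A k i \<inter> E) *\<^sub>R a k i)"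
            by (simp add: sum_subtractf)
          also have "\<dots> \<le> (\<Sum>i<m. e k * measure M (A k i \<inter> E))"
          proof (rule order_trans[OF norm_sum sum_mono])
            fix i
            show "norm (\<nu> (A k i \<inter> E) - measure M (A k i \<inter> E) *\<^sub>R a k i) \<le> e k * measure M (A k i \<inter> E)"
              using A(3)[of k i] AE_sets[of k i] unfolding flat_def a_def by blast
          qed
          also have "\<dots> = e k * (\<Sum>i<m. measure M (A k i \<inter> E))" by (simp add: sum_distrib_left)
          also have "\<dots> \<le> e k * measure M (space M)"
          proof (rule mult_left_mono)
            have "(\<Sum>i<m. measure M (A k i \<inter> E)) \<le> measure M E"
              using sum_le_suminf[OF sums_summable[OF AEk(2)], of "{..<m}"] sums_unique[OF AEk(2)] by simp
            then show "(\<Sum>i<m. measure M (A k i \<inter> E)) \<le> measure M (space M)" using bounded_measure[of E] by linarith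
          qed (use e[of k] in simp)
          finally have head: "norm ((\<Sum>i<m. \<nu> (A k i \<inter> E)) - ?I m) \<le> e k * measure M (space M)" .
          have "?I (N k) - (\<Sum>i<m. \<nu> (A k i \<inter> E)) = - ((?I m - ?I (N k)) + ((\<Sum>i<m. \<nu> (A k i \<inter> E)) - ?I m))" by simp
          then have "norm (?I (N k) - (\<Sum>i<m. \<nu> (A k i \<inter> E))) = norm ((?I m - ?I (N k)) + ((\<Sum>i<m. \<nu> (A k i \<inter> E)) - ?I m))"
            by (simp only: norm_minus_cancel)
          also have "\<dots> \<le> e k + e k * measure M (space M)" by (rule norm_triangle_le[OF add_mono[OF tail head]])
          finally show ?thesis by (simp add: algebra_simps)
        qed
        then have ev: "\<forall>\<^sub>F m in sequentially. norm (?I (N k) - (\<Sum>i<m. \<nu> (A k i \<inter> E))) \<le> (measure M (space M) + 1) * e k"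
          by (auto simp: eventually_sequentially)
        have "(\<lambda>m. norm (?I (N k) - (\<Sum>i<m. \<nu> (A k i \<inter> E)))) \<longlonglongrightarrow> norm (?I (N k) - \<nu> E)"
          using AEk(1) unfolding sums_def by (intro tendsto_intros)
        then show "norm (Bochner_Integration.simple_bochner_integral M (S k) - \<nu> E) \<le> (measure M (space M) + 1) * e k"
          unfolding S_val by (rule tendsto_upperbound[OF _ ev]) simp
      qed
      show "(\<lambda>k. (measure M (space M) + 1) * e k) \<longlonglongrightarrow> 0"
        using tendsto_mult_right_zero[OF e0] by simp
    qed
    ultimately show "has_strong_bochner_integral M (\<lambda>w. indicator E w *\<^sub>R f w) (\<nu> E)"
      unfolding has_strong_bochner_integral_def using S_int by blast
  qed
qed

end

section \<open>Curves of unit speed\<close>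

text \<open>
  The value of \<open>\<phi>\<close> along a curve: time, frozen before 0 and after 1.
\<close>

definition ramp :: "real \<Rightarrow> real" where
  "ramp t = max 0 (min 1 t)"

text \<open>
  Curves are parametrised by \<open>[0, 1]\<close> but defined on the whole line and constant outside that interval,
  which the last condition enforces because \<open>ramp\<close> is constant there. Concatenation thereby becomes a sum.
\<close>

definition curve :: "('x::real_normed_vector \<Rightarrow> real) \<Rightarrow> real \<Rightarrow> 'x \<Rightarrow> (real \<Rightarrow> 'x) \<Rightarrow> bool" where
  "curve \<phi> C b g \<longleftrightarrow>
     g 0 = 0 \<and> g 1 = b \<and> (\<forall>t. \<phi> (g t) = ramp t) \<and>
     (\<forall>s t. s \<le> t \<longrightarrow> norm (g t - g s) \<le> C * (ramp t - ramp s))"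

lemma curve_before:
  assumes "curve \<phi> C b g" "t \<le> 0" shows "g t = 0"
proof -
  have "norm (g 0 - g t) \<le> C * (ramp 0 - ramp t)" "g 0 = 0" using assms unfolding curve_def by blast+
  then show ?thesis using assms(2) by (simp add: ramp_def)
qed

lemma curve_after:
  assumes "curve \<phi> C b g" "1 \<le> t" shows "g t = b"
proof -
  have "norm (g t - g 1) \<le> C * (ramp t - ramp 1)" "g 1 = b" using assms unfolding curve_def by blast+
  then show ?thesis using assms(2) by (simp add: ramp_def)
qed

text \<open>
  The curve \<open>k j\<close>, scaled by \<open>w j\<close> in time and space, runs during the \<open>j\<close>-th of consecutive intervals of
  lengths \<open>w j\<close> and rests before and after. For \<open>w j = 0\<close> the summand is 0 whatever \<open>k j\<close> does, so empty
  pieces are harmless.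
\<close>

definition glue :: "nat \<Rightarrow> (nat \<Rightarrow> real) \<Rightarrow> (nat \<Rightarrow> real \<Rightarrow> 'x::real_vector) \<Rightarrow> real \<Rightarrow> 'x" where
  "glue N w k t = (\<Sum>j<N. w j *\<^sub>R k j ((t - sum w {..<j}) / w j))"

lemma scaled_ramp: "0 \<le> w \<Longrightarrow> w * ramp (x / w) = max 0 (min w x)"
  by (cases "w = 0") (auto simp: ramp_def max_def min_def divide_simps)

lemma clip_add:
  fixes S W t :: real
  assumes "0 \<le> S" "0 \<le> W"
  shows "max 0 (min S t) + max 0 (min W (t - S)) = max 0 (min (S + W) t)"
proof -
  consider "t \<le> 0" | "0 \<le> t" "t \<le> S" | "S \<le> t" "t \<le> S + W" | "S + W \<le> t" by linarith
  then show ?thesis using assms by cases (simp_all add: max_absorb1 max_absorb2 min_absorb1 min_absorb2)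
qed

text \<open>
  Gluing ramps gives a ramp again. This is how equations and estimates in terms of \<open>ramp\<close> pass from
  the pieces to the glued curve.
\<close>

lemma sum_scaled_ramps:
  fixes w :: "nat \<Rightarrow> real"
  assumes "\<And>j. j < N \<Longrightarrow> 0 \<le> w j"
  shows "(\<Sum>j<N. w j * ramp ((t - sum w {..<j}) / w j)) = max 0 (min (sum w {..<N}) t)"
  using assms
proof (induction N)
  case (Suc N)
  have "0 \<le> sum w {..<N}" by (rule sum_nonneg) (use Suc.prems in auto)
  moreover have "0 \<le> w N" using Suc.prems by simp
  moreover have "(\<Sum>j<N. w j * ramp ((t - sum w {..<j}) / w j)) = max 0 (min (sum w {..<N}) t)"
    by (rule Suc.IH) (use Suc.prems in auto)
  ultimately show ?case by (simp only: sum.lessThan_Suc scaled_ramp clip_add)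
qed simp

lemma partial_sum_le:
  fixes w :: "nat \<Rightarrow> real"
  assumes "\<And>j. j < N \<Longrightarrow> 0 \<le> w j" "i < j" "j \<le> N"
  shows "sum w {..<i} + w i \<le> sum w {..<j}"
proof -
  have "sum w {..<Suc i} \<le> sum w {..<j}"
    by (rule sum_mono2) (use assms in auto)
  then show ?thesis by simp
qed

lemma curve_glue:
  fixes k :: "nat \<Rightarrow> real \<Rightarrow> 'x::real_normed_vector"
  assumes \<phi>: "linear \<phi>" and w: "\<And>j. j < N \<Longrightarrow> 0 \<le> w j" "sum w {..<N} = 1"
    and k: "\<And>j. j < N \<Longrightarrow> curve \<phi> C (e j) (k j)"
    and b: "(\<Sum>j<N. w j *\<^sub>R e j) = b"
  shows "curve \<phi> C b (glue N w k)"
proof -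
  have ramp: "(\<Sum>j<N. w j * ramp ((t - sum w {..<j}) / w j)) = ramp t" for t
    using sum_scaled_ramps[of N w t] w by (simp add: ramp_def)
  have "w j *\<^sub>R k j ((0 - sum w {..<j}) / w j) = 0" if "j < N" for j
  proof -
    have "0 \<le> sum w {..<j}" by (rule sum_nonneg) (use w that in auto)
    then have "(0 - sum w {..<j}) / w j \<le> 0" using w(1)[OF that] by (simp add: divide_nonpos_nonneg)
    then show ?thesis using curve_before[OF k[OF that]] by simp
  qed
  then have 0: "glue N w k 0 = 0" unfolding glue_def by (intro sum.neutral) auto
  have "w j *\<^sub>R k j ((1 - sum w {..<j}) / w j) = w j *\<^sub>R e j" if "j < N" for j
  proof (cases "w j = 0")
    case False
    then have "0 < w j" using w(1)[OF that] by simp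
    then have "1 \<le> (1 - sum w {..<j}) / w j"
      using partial_sum_le[of N w j N] w that by (simp add: divide_simps)
    then show ?thesis using curve_after[OF k[OF that]] by simp
  qed simp
  then have 1: "glue N w k 1 = b" unfolding glue_def b[symmetric] by (intro sum.cong) auto
  have 2: "\<phi> (glue N w k t) = ramp t" for t
  proof -
    have "\<phi> (glue N w k t) = (\<Sum>j<N. w j * \<phi> (k j ((t - sum w {..<j}) / w j)))"
      unfolding glue_def using \<phi> by (simp add: linear_sum linear_scale)
    also have "\<dots> = (\<Sum>j<N. w j * ramp ((t - sum w {..<j}) / w j))"
      by (intro sum.cong) (use k in \<open>auto simp: curve_def\<close>)
    finally show ?thesis by (simp add: ramp)
  qed
  have 3: "norm (glue N w k t - glue N w k s) \<le> C * (ramp t - ramp s)" if "s \<le> t" for s t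
  proof -
    have "norm (glue N w k t - glue N w k s)
        = norm (\<Sum>j<N. w j *\<^sub>R (k j ((t - sum w {..<j}) / w j) - k j ((s - sum w {..<j}) / w j)))"
      by (simp add: glue_def sum_subtractf scaleR_diff_right)
    also have "\<dots> \<le> (\<Sum>j<N. w j * (C * (ramp ((t - sum w {..<j}) / w j) - ramp ((s - sum w {..<j}) / w j))))"
    proof (rule order_trans[OF norm_sum sum_mono])
      fix j assume "j \<in> {..<N}"
      then have j: "j < N" by simp
      have "(s - sum w {..<j}) / w j \<le> (t - sum w {..<j}) / w j"
        using w(1)[OF j] that by (simp add: divide_right_mono)
      then have "norm (k j ((t - sum w {..<j}) / w j) - k j ((s - sum w {..<j}) / w j))
        \<le> C * (ramp ((t - sum w {..<j}) / w j) - ramp ((s - sum w {..<j}) / w j))"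
        using k[OF j] unfolding curve_def by blast
      then show "norm (w j *\<^sub>R (k j ((t - sum w {..<j}) / w j) - k j ((s - sum w {..<j}) / w j)))
        \<le> w j * (C * (ramp ((t - sum w {..<j}) / w j) - ramp ((s - sum w {..<j}) / w j)))"
        using w(1)[OF j] by (simp add: mult_left_mono)
    qed
    also have "\<dots> = (\<Sum>j<N. C * (w j * ramp ((t - sum w {..<j}) / w j) - w j * ramp ((s - sum w {..<j}) / w j)))"
      by (intro sum.cong) (auto simp: right_diff_distrib)
    also have "\<dots> = C * ((\<Sum>j<N. w j * ramp ((t - sum w {..<j}) / w j)) - (\<Sum>j<N. w j * ramp ((s - sum w {..<j}) / w j)))"
      by (simp only: sum_distrib_left[symmetric] sum_subtractf)
    finally show ?thesis by (simp add: ramp)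
  qed
  show ?thesis unfolding curve_def using 0 1 2 3 by blast
qed

definition zigzag :: "(real \<Rightarrow> 'x::real_vector) \<Rightarrow> (real \<Rightarrow> 'x) \<Rightarrow> real \<Rightarrow> 'x" where
  "zigzag g h = glue 2 (\<lambda>_. 1/2) (\<lambda>j. if j = 0 then g else h)"

lemma curve_zigzag:
  assumes "linear \<phi>" "curve \<phi> C b g" "curve \<phi> C b' h"
  shows "curve \<phi> C ((1/2) *\<^sub>R (b + b')) (zigzag g h)"
  unfolding zigzag_def
  by (rule curve_glue[where e="\<lambda>j. if j = 0 then b else b'"])
    (use assms in \<open>auto simp: numeral_2_eq_2 scaleR_add_right\<close>)

section \<open>Glued differences\<close>

text \<open>
  Differences of two curves with the same end point.
\<close>

definition bump :: "(real \<Rightarrow> 'x::zero) \<Rightarrow> bool" where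
  "bump f \<longleftrightarrow> (\<forall>t. t \<le> 0 \<or> 1 \<le> t \<longrightarrow> f t = 0)"

lemma bump_curve_diff:
  "curve \<phi> C b g \<Longrightarrow> curve \<phi> C b h \<Longrightarrow> bump (\<lambda>t. g t - h t)"
  unfolding bump_def by (auto simp: curve_before curve_after)

lemma glue_diff: "glue N w k t - glue N w k' t = glue N w (\<lambda>j t. k j t - k' j t) t"
  by (simp add: glue_def sum_subtractf scaleR_diff_right)

lemma zigzag_diff:
  "zigzag g h t - zigzag g' h' t = glue 2 (\<lambda>_. 1/2) (\<lambda>j. if j = 0 then (\<lambda>t. g t - g' t) else (\<lambda>t. h t - h' t)) t"
  unfolding zigzag_def glue_diff by (intro arg_cong[of _ _ "\<lambda>f. glue 2 _ f t"]) auto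

lemma glue_bump_piece:
  fixes f :: "nat \<Rightarrow> real \<Rightarrow> 'x::real_vector"
  assumes w: "\<And>j. j < N \<Longrightarrow> 0 \<le> w j" and f: "\<And>j. j < N \<Longrightarrow> bump (f j)"
    and j: "j < N" and u: "0 \<le> u" "u \<le> 1"
  shows "glue N w f (sum w {..<j} + w j * u) = w j *\<^sub>R f j u"
proof -
  define t where "t = sum w {..<j} + w j * u"
  have t: "sum w {..<j} \<le> t" "t \<le> sum w {..<j} + w j"
    using w[OF j] u by (auto simp: t_def mult_left_le)
  have "w i *\<^sub>R f i ((t - sum w {..<i}) / w i) = (if i = j then w j *\<^sub>R f j u else 0)" if i: "i < N" for i
  proof (cases "w i = 0")
    case True then show ?thesis by auto
  next
    case False
    with w[OF i] have wi: "0 < w i" by simp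
    consider "i = j" | "i < j" | "j < i" by linarith
    then show ?thesis
    proof cases
      case 1 then show ?thesis using wi by (simp add: t_def)
    next
      case 2
      then have "sum w {..<i} + w i \<le> sum w {..<j}" using partial_sum_le[of N w i j] w j by auto
      then have "1 \<le> (t - sum w {..<i}) / w i" using t wi by (simp add: divide_simps)
      then show ?thesis using 2 f[OF i] by (simp add: bump_def)
    next
      case 3
      then have "sum w {..<j} + w j \<le> sum w {..<i}" using partial_sum_le[of N w j i] w i by auto
      then have "(t - sum w {..<i}) / w i \<le> 0" using t wi by (simp add: divide_simps)
      then show ?thesis using 3 f[OF i] by (simp add: bump_def)
    qed
  qed
  then have "glue N w f t = (\<Sum>i<N. if i = j then w j *\<^sub>R f j u else 0)"
    unfolding glue_def by (intro sum.cong) auto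
  also have "\<dots> = w j *\<^sub>R f j u" using j by simp
  finally show ?thesis by (simp add: t_def)
qed

text \<open>
  At most one summand is nonzero at any time, so the estimate is by the largest weight and not by the sum
  of the weights.
\<close>

lemma glue_bump_bound:
  fixes f :: "nat \<Rightarrow> real \<Rightarrow> 'x::real_normed_vector"
  assumes "\<And>j. j < N \<Longrightarrow> 0 \<le> w j" "\<And>j. j < N \<Longrightarrow> w j \<le> W"
    and "\<And>j. j < N \<Longrightarrow> bump (f j)" "\<And>j t. j < N \<Longrightarrow> norm (f j t) \<le> D" and "0 \<le> W" "0 \<le> D"
  shows "norm (glue N w f t) \<le> W * D"
  using assms(1-4)
proof (induction N)
  case 0
  then show ?case using assms(5,6) by (simp add: glue_def)
next
  case (Suc N)
  let ?x = "(t - sum w {..<N}) / w N"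
  have glue: "glue (Suc N) w f t = glue N w f t + w N *\<^sub>R f N ?x"
    by (simp add: glue_def)
  show ?case
  proof (cases "t \<le> sum w {..<N} \<or> w N = 0")
    case True
    have last: "w N *\<^sub>R f N ?x = 0"
    proof (cases "w N = 0")
      case False
      with Suc.prems(1)[of N] have "0 < w N" by simp
      with True have "?x \<le> 0" by (simp add: divide_simps)
      then show ?thesis using Suc.prems(3)[of N] by (simp add: bump_def)
    qed simp
    moreover have "norm (glue N w f t) \<le> W * D" by (rule Suc.IH) (use Suc.prems in auto)
    ultimately show ?thesis unfolding glue last by simp
  next
    case False
    have "w i *\<^sub>R f i ((t - sum w {..<i}) / w i) = 0" if i: "i < N" for i
    proof (cases "w i = 0")
      case wi: False
      have "sum w {..<i} + w i \<le> sum w {..<N}"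
        by (rule partial_sum_le[where N=N]) (use Suc.prems i in auto)
      moreover have "0 < w i" using wi Suc.prems(1)[of i] i by simp
      ultimately have "1 \<le> (t - sum w {..<i}) / w i" using False by (simp add: divide_simps)
      then show ?thesis using Suc.prems(3)[of i] i by (simp add: bump_def)
    qed simp
    then have "glue N w f t = 0" unfolding glue_def by (intro sum.neutral) auto
    moreover have "norm (w N *\<^sub>R f N ?x) \<le> W * D"
      using Suc.prems(1,2,4)[of N] by (auto intro!: mult_mono)
    ultimately show ?thesis using glue by simp
  qed
qed

section \<open>Deviations between common points\<close>

text \<open>
  The interlacing condition in the definition of thickness, for the difference \<open>f\<close> of two curves on
  \<open>[a, c]\<close>. The sequence of common points \<open>q\<close> starts in \<open>a\<close> and ends in \<open>c\<close>, with one \<open>s i\<close> in each gap, so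
  that deviations on adjacent intervals can be joined.
\<close>

definition deviates :: "(real \<Rightarrow> 'x::real_normed_vector) \<Rightarrow> real \<Rightarrow> real \<Rightarrow> real set \<Rightarrow> real \<Rightarrow> bool" where
  "deviates f a c Q \<alpha> \<longleftrightarrow>
     (\<exists>(m::nat) q s. q 0 = a \<and> q m = c \<and> (\<forall>i<m. q i \<le> s i \<and> s i \<le> q (Suc i)) \<and>
        (\<forall>i\<le>m. f (q i) = 0) \<and> Q \<subseteq> q ` {..m} \<and> \<alpha> \<le> (\<Sum>i<m. norm (f (s i))))"

lemma deviates_mono: "deviates f a c Q \<alpha> \<Longrightarrow> Q' \<subseteq> Q \<Longrightarrow> \<alpha>' \<le> \<alpha> \<Longrightarrow> deviates f a c Q' \<alpha>'"
  unfolding deviates_def by (elim exE conjE, intro exI conjI) (assumption | (rule order_trans; assumption))+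

lemma deviates_eq_0: "deviates f a c Q \<alpha> \<Longrightarrow> t \<in> Q \<Longrightarrow> f t = 0"
  unfolding deviates_def by blast

lemma deviates_refl: "f a = 0 \<Longrightarrow> deviates f a a {a} 0"
  unfolding deviates_def by (intro exI[of _ 0] exI[of _ "\<lambda>_. a"]) auto

lemma deviates_once:
  assumes "f a = 0" "f c = 0" "a \<le> s" "s \<le> c"
  shows "deviates f a c {a, c} (norm (f s))"
  unfolding deviates_def
  by (rule exI[of _ 1], rule exI[of _ "\<lambda>i. if i = 0 then a else c"], rule exI[of _ "\<lambda>_. s"])
    (use assms in auto)

lemma deviates_join:
  assumes "deviates f a b Q \<alpha>" "deviates f b c R \<beta>"
  shows "deviates f a c (Q \<union> R) (\<alpha> + \<beta>)"
proof -
  obtain m q s where 1: "q 0 = a" "q m = b" "\<And>i. i < m \<Longrightarrow> q i \<le> s i \<and> s i \<le> q (Suc i)"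
      "\<And>i. i \<le> m \<Longrightarrow> f (q i) = 0" "Q \<subseteq> q ` {..m}" "\<alpha> \<le> (\<Sum>i<m. norm (f (s i)))"
    using assms(1) unfolding deviates_def by blast
  obtain m' q' s' where 2: "q' 0 = b" "q' m' = c" "\<And>i. i < m' \<Longrightarrow> q' i \<le> s' i \<and> s' i \<le> q' (Suc i)"
      "\<And>i. i \<le> m' \<Longrightarrow> f (q' i) = 0" "R \<subseteq> q' ` {..m'}" "\<beta> \<le> (\<Sum>i<m'. norm (f (s' i)))"
    using assms(2) unfolding deviates_def by blast
  define p where "p i = (if i \<le> m then q i else q' (i - m))" for i
  define r where "r i = (if i < m then s i else s' (i - m))" for i
  have p': "p (m + i) = q' i" for i using 1(2) 2(1) by (auto simp: p_def)
  have "p i \<le> r i \<and> r i \<le> p (Suc i)" if i: "i < m + m'" for i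
  proof (cases "i < m")
    case True then show ?thesis using 1(3)[OF True] by (auto simp: p_def r_def)
  next
    case False
    then obtain j where "i = m + j" using le_Suc_ex not_less by blast
    then show ?thesis using 2(3)[of j] p'[of j] p'[of "Suc j"] i by (simp add: r_def)
  qed
  moreover have "f (p i) = 0" if "i \<le> m + m'" for i
    using 1(4)[of i] 2(4)[of "i - m"] that by (auto simp: p_def)
  moreover have "Q \<union> R \<subseteq> p ` {..m + m'}"
  proof -
    have "q ` {..m} \<subseteq> p ` {..m + m'}"
    proof (safe)
      fix i assume "i \<le> m"
      then show "q i \<in> p ` {..m + m'}" by (intro image_eqI[of _ _ i]) (auto simp: p_def)
    qed
    moreover have "q' ` {..m'} \<subseteq> p ` {..m + m'}"
    proof (safe)
      fix i assume "i \<le> m'"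
      then show "q' i \<in> p ` {..m + m'}" by (intro image_eqI[of _ _ "m + i"]) (auto simp: p')
    qed
    ultimately show ?thesis using 1(5) 2(5) by blast
  qed
  moreover have "(\<Sum>i<m + m'. norm (f (r i))) = (\<Sum>i<m. norm (f (s i))) + (\<Sum>i<m'. norm (f (s' i)))"
  proof -
    have "(\<Sum>i<m + m'. norm (f (r i))) = (\<Sum>i<m. norm (f (r i))) + (\<Sum>i\<in>{m..<m+m'}. norm (f (r i)))"
      by (subst sum.union_disjoint[symmetric]) (auto intro!: sum.cong)
    also have "(\<Sum>i\<in>{m..<m+m'}. norm (f (r i))) = (\<Sum>i<m'. norm (f (r (i + m))))"
      using sum.shift_bounds_nat_ivl[of "\<lambda>i. norm (f (r i))" 0 m m'] by (simp add: add.commute atLeast0LessThan)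
    finally show ?thesis by (simp add: r_def)
  qed
  moreover have "p 0 = a" "p (m + m') = c" using 1(1) 2(2) p'[of m'] by (simp_all add: p_def)
  ultimately show ?thesis
    unfolding deviates_def using 1(6) 2(6)
    by (intro exI[of _ "m + m'"] exI[of _ p] exI[of _ r]) simp
qed

lemma interlaced_bounds:
  fixes q :: "nat \<Rightarrow> real"
  assumes "\<And>i. i < m \<Longrightarrow> q i \<le> s i \<and> s i \<le> q (Suc i)" "i \<le> m"
  shows "q 0 \<le> q i" "q i \<le> q m"
proof -
  have "q j \<le> q k" if "j \<le> k" "k \<le> m" for j k
    using that
  proof (induction k rule: dec_induct)
    case (step k) then show ?case using assms(1)[of k] by force
  qed simp
  then show "q 0 \<le> q i" "q i \<le> q m" using assms(2) by auto
qed

lemma deviates_rescale: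
  assumes "deviates f 0 1 Q \<alpha>" and w: "0 \<le> w"
    and F: "\<And>u. 0 \<le> u \<Longrightarrow> u \<le> 1 \<Longrightarrow> F (p + w * u) = w *\<^sub>R f u"
  shows "deviates F p (p + w) ((\<lambda>u. p + w * u) ` Q) (w * \<alpha>)"
proof -
  obtain m q s where 1: "q 0 = 0" "q m = 1" "\<And>i. i < m \<Longrightarrow> q i \<le> s i \<and> s i \<le> q (Suc i)"
      "\<And>i. i \<le> m \<Longrightarrow> f (q i) = 0" "Q \<subseteq> q ` {..m}" "\<alpha> \<le> (\<Sum>i<m. norm (f (s i)))"
    using assms(1) unfolding deviates_def by blast
  have q: "0 \<le> q i" "q i \<le> 1" if "i \<le> m" for i
    using interlaced_bounds[of m q s i] 1(1-3) that by auto
  have s: "0 \<le> s i" "s i \<le> 1" if "i < m" for i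
    using q[of i] q[of "Suc i"] 1(3)[OF that] that by auto
  have "w * \<alpha> \<le> (\<Sum>i<m. norm (F (p + w * s i)))"
  proof -
    have "(\<Sum>i<m. norm (F (p + w * s i))) = w * (\<Sum>i<m. norm (f (s i)))"
      unfolding sum_distrib_left by (intro sum.cong) (use s F w in auto)
    then show ?thesis using 1(6) w by (simp add: mult_left_mono)
  qed
  moreover have "p + w * q i \<le> p + w * s i \<and> p + w * s i \<le> p + w * q (Suc i)" if "i < m" for i
    using 1(3)[OF that] w by (simp add: mult_left_mono)
  moreover have "F (p + w * q i) = 0" if "i \<le> m" for i using F q 1(4) that by simp
  moreover have "(\<lambda>u. p + w * u) ` Q \<subseteq> (\<lambda>i. p + w * q i) ` {..m}" using 1(5) by blast
  ultimately show ?thesis unfolding deviates_def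
    using 1(1,2)
    by (intro exI[of _ m] exI[of _ "\<lambda>i. p + w * q i"] exI[of _ "\<lambda>i. p + w * s i"]) simp
qed

lemma deviates_glue:
  fixes f :: "nat \<Rightarrow> real \<Rightarrow> 'x::real_normed_vector"
  assumes w: "\<And>j. j < N \<Longrightarrow> 0 \<le> w j" and f: "\<And>j. j < N \<Longrightarrow> bump (f j)"
    and dev: "\<And>j. j < N \<Longrightarrow> deviates (f j) 0 1 (Q j) (\<alpha> j)" and N: "n \<le> N"
  shows "deviates (glue N w f) 0 (sum w {..<n})
    (\<Union>j<n. (\<lambda>u. sum w {..<j} + w j * u) ` Q j) (\<Sum>j<n. w j * \<alpha> j)"
  using N
proof (induction n)
  case 0
  have "glue N w f 0 = 0"
  proof (cases "N = 0")
    case False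
    then have "0 < N" by simp
    then show ?thesis using glue_bump_piece[where N=N and w=w and f=f and j=0 and u=0] w f by (simp add: bump_def)
  qed (simp add: glue_def)
  from deviates_refl[of "glue N w f", OF this] show ?case by (auto elim: deviates_mono)
next
  case (Suc n)
  then have n: "n < N" by simp
  have "deviates (glue N w f) (sum w {..<n}) (sum w {..<n} + w n)
      ((\<lambda>u. sum w {..<n} + w n * u) ` Q n) (w n * \<alpha> n)"
    by (rule deviates_rescale[OF dev[OF n] w[OF n]]) (use glue_bump_piece[where N=N and w=w and f=f, OF w f n] in auto)
  from deviates_join[OF Suc.IH this] n show ?case
    by (simp add: lessThan_Suc Un_commute add.commute)
qed

text \<open>
  Needed where a curve is left unchanged although common points are prescribed. The points are inserted in
  increasing order.
\<close>

lemma deviates_zero: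
  assumes "finite Q" "Q \<subseteq> {a..c}" "a \<le> c"
  shows "deviates (\<lambda>_. 0::'x::real_normed_vector) a c Q 0"
  using assms
proof (induction arbitrary: c rule: finite_linorder_max_induct)
  case empty
  then show ?case using deviates_once[of "\<lambda>_. 0::'x" a c a] by (auto elim: deviates_mono)
next
  case (insert b A)
  have "deviates (\<lambda>_. 0::'x) a b A 0" by (rule insert.IH) (use insert.hyps insert.prems in force)+
  moreover have "deviates (\<lambda>_. 0::'x) b c {b, c} (norm (0::'x))"
    by (rule deviates_once[of _ _ _ b]) (use insert in auto)
  ultimately have "deviates (\<lambda>_. 0::'x) a c (A \<union> {b, c}) (0 + norm (0::'x))" by (rule deviates_join)
  then show ?case by (auto elim: deviates_mono)
qed

definition localize :: "(nat \<Rightarrow> real) \<Rightarrow> nat \<Rightarrow> real set \<Rightarrow> real set" where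
  "localize w j Q = (\<lambda>t. (t - sum w {..<j}) / w j) ` (Q \<inter> {sum w {..<j} .. sum w {..<j} + w j})"

lemma localize_unit: 
  assumes "0 \<le> w j" shows "localize w j Q \<subseteq> {0..1}"
  using assms by (cases "w j = 0") (auto simp: localize_def divide_simps)

lemma localize_cover:
  assumes w: "\<And>j. j < N \<Longrightarrow> 0 \<le> w j"
  shows "n \<le> N \<Longrightarrow> 0 < n \<Longrightarrow>
    Q \<inter> {0..sum w {..<n}} \<subseteq> (\<Union>j<n. (\<lambda>u. sum w {..<j} + w j * u) ` localize w j Q)"
proof (induction n)
  case (Suc n)
  have piece: "Q \<inter> {sum w {..<n} .. sum w {..<n} + w n} \<subseteq> (\<lambda>u. sum w {..<n} + w n * u) ` localize w n Q"
  proof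
    fix t assume t: "t \<in> Q \<inter> {sum w {..<n} .. sum w {..<n} + w n}"
    then have "(t - sum w {..<n}) / w n \<in> localize w n Q" by (auto simp: localize_def)
    moreover have "sum w {..<n} + w n * ((t - sum w {..<n}) / w n) = t"
      using t by (cases "w n = 0") auto
    ultimately show "t \<in> (\<lambda>u. sum w {..<n} + w n * u) ` localize w n Q"
      by (intro image_eqI[of _ _ "(t - sum w {..<n}) / w n"]) simp_all
  qed
  show ?case
  proof (cases "n = 0")
    case True then show ?thesis using piece by (simp add: lessThan_Suc)
  next
    case False
    then have "Q \<inter> {0..sum w {..<n}} \<subseteq> (\<Union>j<n. (\<lambda>u. sum w {..<j} + w j * u) ` localize w j Q)"
      using Suc.IH Suc.prems by simp
    moreover have "Q \<inter> {0..sum w {..<Suc n}} \<subseteq> Q \<inter> {0..sum w {..<n}} \<union> Q \<inter> {sum w {..<n} .. sum w {..<n} + w n}"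
      by auto
    moreover have "(\<Union>j<Suc n. (\<lambda>u. sum w {..<j} + w j * u) ` localize w j Q)
        = (\<Union>j<n. (\<lambda>u. sum w {..<j} + w j * u) ` localize w j Q) \<union> (\<lambda>u. sum w {..<n} + w n * u) ` localize w n Q"
      unfolding lessThan_Suc by simp (rule Un_commute)
    ultimately show ?thesis using piece by (simp only:) (rule subset_trans, assumption, rule Un_mono)
  qed
qed simp

text \<open>
  Only interior points are counted: a break point of the glued curve is common to both curves anyway.
\<close>

lemma localize_count:
  assumes w: "\<And>j. j < N \<Longrightarrow> 0 \<le> w j" and Q: "finite Q"
  shows "n \<le> N \<Longrightarrow> (\<Sum>j<n. card (localize w j Q \<inter> {0<..<1})) \<le> card (Q \<inter> {0<..<sum w {..<n}})"
proof (induction n)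
  case (Suc n)
  have p: "0 \<le> sum w {..<n}" by (rule sum_nonneg) (use w Suc.prems in auto)
  have "localize w n Q \<inter> {0<..<1} \<subseteq> (\<lambda>t. (t - sum w {..<n}) / w n) ` (Q \<inter> {sum w {..<n} <..< sum w {..<n} + w n})"
  proof
    fix x assume x: "x \<in> localize w n Q \<inter> {0<..<1}"
    then obtain t where t: "t \<in> Q" "x = (t - sum w {..<n}) / w n" unfolding localize_def by blast
    have wn: "0 < w n" using w[of n] Suc.prems x t by (cases "w n = 0") auto
    then have "t = sum w {..<n} + w n * x" using t(2) by simp
    then have "t \<in> Q \<inter> {sum w {..<n} <..< sum w {..<n} + w n}" using x wn t(1) by simp
    then show "x \<in> (\<lambda>t. (t - sum w {..<n}) / w n) ` (Q \<inter> {sum w {..<n} <..< sum w {..<n} + w n})"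
      using t by blast
  qed
  then have "card (localize w n Q \<inter> {0<..<1})
      \<le> card ((\<lambda>t. (t - sum w {..<n}) / w n) ` (Q \<inter> {sum w {..<n} <..< sum w {..<n} + w n}))"
    using Q by (intro card_mono) simp_all
  also have "\<dots> \<le> card (Q \<inter> {sum w {..<n} <..< sum w {..<n} + w n})"
    using Q by (intro card_image_le) simp
  finally have "card (localize w n Q \<inter> {0<..<1}) \<le> card (Q \<inter> {sum w {..<n} <..< sum w {..<n} + w n})" .
  moreover have "card (Q \<inter> {0<..<sum w {..<n}}) + card (Q \<inter> {sum w {..<n} <..< sum w {..<n} + w n})
      = card (Q \<inter> {0<..<sum w {..<n}} \<union> Q \<inter> {sum w {..<n} <..< sum w {..<n} + w n})"
    using Q by (intro card_Un_disjoint[symmetric]) auto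
  moreover have "\<dots> \<le> card (Q \<inter> {0<..<sum w {..<Suc n}})"
  proof (rule card_mono)
    have "0 \<le> w n" using w Suc.prems by simp
    then show "Q \<inter> {0<..<sum w {..<n}} \<union> Q \<inter> {sum w {..<n}<..<sum w {..<n} + w n} \<subseteq> Q \<inter> {0<..<sum w {..<Suc n}}"
      using p by auto
  qed (use Q in simp)
  moreover have "(\<Sum>j<n. card (localize w j Q \<inter> {0<..<1})) \<le> card (Q \<inter> {0<..<sum w {..<n}})"
    using Suc.IH Suc.prems by simp
  ultimately show ?case by (simp only: sum.lessThan_Suc)
qed simp

text \<open>
  In a lower bound of the form \<open>A * (1 - c * card Q)\<close> gluing improves the constant \<open>c\<close> by the largest
  weight \<open>W\<close>, because each prescribed point spoils only the piece that contains it.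
\<close>

lemma deviates_glue_count:
  fixes f :: "nat \<Rightarrow> real \<Rightarrow> 'x::real_normed_vector" and A c W :: real
  assumes w: "\<And>j. j < N \<Longrightarrow> 0 \<le> w j" "sum w {..<N} = 1" "\<And>j. j < N \<Longrightarrow> w j \<le> W"
    and f: "\<And>j. j < N \<Longrightarrow> bump (f j)" and Q: "finite Q" "Q \<subseteq> {0..1}" and A: "0 \<le> A" "0 \<le> c" "0 \<le> W"
    and dev: "\<And>j. j < N \<Longrightarrow>
      deviates (f j) 0 1 (localize w j Q) (A * (1 - c * card (localize w j Q \<inter> {0<..<1})))"
  shows "deviates (glue N w f) 0 1 Q (A * (1 - c * W * card (Q \<inter> {0<..<1})))"
proof -
  let ?c = "\<lambda>j. real (card (localize w j Q \<inter> {0<..<1}))"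
  have "N \<noteq> 0" using w(2) by (cases N) auto
  have "deviates (glue N w f) 0 1 (\<Union>j<N. (\<lambda>u. sum w {..<j} + w j * u) ` localize w j Q)
      (\<Sum>j<N. w j * (A * (1 - c * ?c j)))"
    using deviates_glue[where w=w and f=f and n=N and N=N, OF w(1) f dev order_refl] w(2) by simp
  moreover have "Q \<subseteq> (\<Union>j<N. (\<lambda>u. sum w {..<j} + w j * u) ` localize w j Q)"
    using localize_cover[where w=w and N=N and n=N and Q=Q, OF w(1) order_refl] \<open>N \<noteq> 0\<close> Q(2)
    unfolding w(2) by (simp add: inf_absorb1)
  moreover have "A * (1 - c * W * card (Q \<inter> {0<..<1})) \<le> (\<Sum>j<N. w j * (A * (1 - c * ?c j)))"
  proof -
    have "(\<Sum>j<N. w j * ?c j) \<le> (\<Sum>j<N. W * ?c j)"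
      by (intro sum_mono mult_right_mono) (use w in auto)
    also have "\<dots> = W * real (\<Sum>j<N. card (localize w j Q \<inter> {0<..<1}))" by (simp add: sum_distrib_left)
    also have "\<dots> \<le> W * card (Q \<inter> {0<..<1})"
    proof (rule mult_left_mono[OF _ A(3)])
      have "(\<Sum>j<N. card (localize w j Q \<inter> {0<..<1})) \<le> card (Q \<inter> {0<..<1})"
        using localize_count[where w=w and N=N and n=N, OF w(1) Q(1) order_refl] unfolding w(2) .
      then show "real (\<Sum>j<N. card (localize w j Q \<inter> {0<..<1})) \<le> real (card (Q \<inter> {0<..<1}))"
        by (rule of_nat_mono)
    qed
    finally have "A * (1 - c * (W * card (Q \<inter> {0<..<1}))) \<le> A * (1 - c * (\<Sum>j<N. w j * ?c j))"
      using A by (intro mult_left_mono diff_left_mono) auto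
    also have "\<dots> = (\<Sum>j<N. w j) * A - (\<Sum>j<N. w j * ?c j) * (A * c)" using w(2) by (simp add: algebra_simps)
    also have "\<dots> = (\<Sum>j<N. w j * A - w j * ?c j * (A * c))"
      by (simp only: sum_distrib_right sum_subtractf)
    also have "\<dots> = (\<Sum>j<N. w j * (A * (1 - c * ?c j)))"
      by (intro sum.cong) (auto simp: algebra_simps)
    finally show ?thesis by (simp add: mult.assoc)
  qed
  ultimately show ?thesis by (rule deviates_mono)
qed

section \<open>Branching curves over a bush\<close>

text \<open>
  Every \<open>b\<close> in \<open>B\<close> is a convex combination of the points \<open>\<beta> b i\<close>, which again belong to \<open>B\<close> and are far from
  \<open>b\<close> in weighted mean, though possibly not one by one. The functional \<open>\<phi>\<close> measures time: \<open>\<phi> = 1\<close> on \<open>B\<close>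
  means that all directions in \<open>B\<close> have the same speed.
\<close>

locale bush =
  fixes \<phi> :: "'x::banach \<Rightarrow> real" and B :: "'x set" and C \<delta> :: real
    and n :: "'x \<Rightarrow> nat" and w :: "'x \<Rightarrow> nat \<Rightarrow> real" and \<beta> :: "'x \<Rightarrow> nat \<Rightarrow> 'x"
  assumes \<phi>: "bounded_linear \<phi>"
    and \<phi>_B: "b \<in> B \<Longrightarrow> \<phi> b = 1"
    and norm_B: "b \<in> B \<Longrightarrow> norm b \<le> C"
    and \<beta>_B: "b \<in> B \<Longrightarrow> i < n b \<Longrightarrow> \<beta> b i \<in> B"
    and w_nonneg: "b \<in> B \<Longrightarrow> i < n b \<Longrightarrow> 0 \<le> w b i"
    and w_sum: "b \<in> B \<Longrightarrow> sum (w b) {..<n b} = 1"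
    and mean: "b \<in> B \<Longrightarrow> (\<Sum>i<n b. w b i *\<^sub>R \<beta> b i) = b"
    and spread: "b \<in> B \<Longrightarrow> \<delta> \<le> (\<Sum>i<n b. w b i * norm (b - \<beta> b i))"
    and \<delta>_pos: "0 < \<delta>"
begin

lemma linear_\<phi>: "linear \<phi>" using \<phi> by (rule bounded_linear.linear)

lemma w_le_1: "b \<in> B \<Longrightarrow> i < n b \<Longrightarrow> w b i \<le> 1"
  using member_le_sum[of i "{..<n b}" "w b"] w_nonneg w_sum by auto

lemma curve_node:
  assumes b: "b \<in> B" and k: "\<And>i. i < n b \<Longrightarrow> curve \<phi> C ((1/2) *\<^sub>R (b + \<beta> b i)) (k i)"
  shows "curve \<phi> C b (glue (n b) (w b) k)"
proof (rule curve_glue[OF linear_\<phi> w_nonneg[OF b] w_sum[OF b] k])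
  have "(\<Sum>j<n b. w b j *\<^sub>R (1/2) *\<^sub>R (b + \<beta> b j)) = (1/2) *\<^sub>R (\<Sum>j<n b. w b j *\<^sub>R b + w b j *\<^sub>R \<beta> b j)"
    by (simp add: scaleR_sum_right scaleR_add_right)
  also have "\<dots> = (1/2) *\<^sub>R (sum (w b) {..<n b} *\<^sub>R b + (\<Sum>j<n b. w b j *\<^sub>R \<beta> b j))"
    by (simp add: sum.distrib scaleR_sum_left)
  also have "\<dots> = b" using w_sum[OF b] mean[OF b] by (simp flip: scaleR_add_left add: scaleR_add_right)
  finally show "(\<Sum>j<n b. w b j *\<^sub>R (1/2) *\<^sub>R (b + \<beta> b j)) = b" .
qed

text \<open>
  The decomposition must continue at all scales, since the pieces to be exchanged are found only between
  the prescribed points; hence a greatest fixed point. Either order of the two halves is allowed in each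
  zigzag, independently of all others.
\<close>

coinductive branching :: "'x \<Rightarrow> (real \<Rightarrow> 'x) \<Rightarrow> bool" where
  node: "b \<in> B \<Longrightarrow> curve \<phi> C b (glue (n b) (w b) k) \<Longrightarrow>
    (\<And>i. i < n b \<Longrightarrow> \<exists>g h. branching b g \<and> branching (\<beta> b i) h \<and> (k i = zigzag g h \<or> k i = zigzag h g)) \<Longrightarrow>
    branching b (glue (n b) (w b) k)"

lemma branching_curve: "branching b g \<Longrightarrow> curve \<phi> C b g"
  by (auto elim: branching.cases)

lemma branching_glue:
  assumes b: "b \<in> B"
    and k: "\<And>i. i < n b \<Longrightarrow> \<exists>g h. branching b g \<and> branching (\<beta> b i) h \<and> (k i = zigzag g h \<or> k i = zigzag h g)"
  shows "branching b (glue (n b) (w b) k)"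
proof (rule node[OF b curve_node[OF b] k])
  fix i assume "i < n b"
  then obtain g h where gh: "branching b g" "branching (\<beta> b i) h" "k i = zigzag g h \<or> k i = zigzag h g"
    using k by blast
  note c = branching_curve[OF gh(1)] branching_curve[OF gh(2)]
  show "curve \<phi> C ((1/2) *\<^sub>R (b + \<beta> b i)) (k i)"
    using gh(3) curve_zigzag[OF linear_\<phi> c(1,2)] curve_zigzag[OF linear_\<phi> c(2,1)] by (auto simp: add.commute)
qed

text \<open>
  Existence of branching curves by iteration, starting from straight lines and always putting \<open>b\<close> first.
\<close>

primrec approx :: "nat \<Rightarrow> 'x \<Rightarrow> real \<Rightarrow> 'x" where
  "approx 0 b = (\<lambda>t. ramp t *\<^sub>R b)"
| "approx (Suc k) b = glue (n b) (w b) (\<lambda>i. zigzag (approx k b) (approx k (\<beta> b i)))"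

lemma approx_curve: "b \<in> B \<Longrightarrow> curve \<phi> C b (approx k b)"
proof (induction k arbitrary: b)
  case 0
  have "norm (ramp t *\<^sub>R b - ramp s *\<^sub>R b) \<le> C * (ramp t - ramp s)" if "s \<le> t" for s t
  proof -
    have "0 \<le> ramp t - ramp s" using that by (auto simp: ramp_def max_def min_def)
    then have "norm ((ramp t - ramp s) *\<^sub>R b) \<le> C * (ramp t - ramp s)"
      using mult_right_mono[OF norm_B[OF 0], of "ramp t - ramp s"] by (simp add: mult.commute)
    then show ?thesis by (simp add: scaleR_diff_left)
  qed
  then show ?case
    using \<phi>_B[OF 0] linear_\<phi> by (simp add: curve_def linear_scale) (simp add: ramp_def)
next
  case (Suc k)
  show ?case unfolding approx.simps
    by (rule curve_node[OF Suc.prems curve_zigzag[OF linear_\<phi> Suc.IH Suc.IH]]) (use Suc.prems \<beta>_B in auto)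
qed

lemma norm_curve_le:
  assumes "curve \<phi> C b g" shows "norm (g t) \<le> \<bar>C\<bar>"
proof (cases "t \<le> 0")
  case True then show ?thesis using curve_before[OF assms] by simp
next
  case False
  then have "norm (g t - g 0) \<le> C * (ramp t - ramp 0)" using assms unfolding curve_def by (meson linear)
  also have "\<dots> \<le> \<bar>C\<bar> * 1" by (rule mult_mono) (auto simp: ramp_def)
  finally show ?thesis using assms by (simp add: curve_def)
qed

text \<open>
  Both zigzag halves have length 1/2, and at any time only one piece differs; so each iteration halves
  the distance.
\<close>

lemma approx_step:
  "b \<in> B \<Longrightarrow> norm (approx (Suc k) b t - approx k b t) \<le> 2 * \<bar>C\<bar> * (1/2) ^ k"
proof (induction k arbitrary: b t)
  case 0
  have "norm (approx (Suc 0) b t - approx 0 b t) \<le> norm (approx (Suc 0) b t) + norm (approx 0 b t)"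
    by (rule norm_triangle_ineq4)
  also have "\<dots> \<le> \<bar>C\<bar> + \<bar>C\<bar>"
    by (intro add_mono norm_curve_le[OF approx_curve[OF 0]])
  finally show ?case by simp
next
  case (Suc k)
  define f where "f i t = zigzag (approx (Suc k) b) (approx (Suc k) (\<beta> b i)) t
      - zigzag (approx k b) (approx k (\<beta> b i)) t" for i t
  define D where "D = 2 * \<bar>C\<bar> * (1/2) ^ k"
  have D: "0 \<le> D" by (simp add: D_def)
  have diff: "approx (Suc (Suc k)) b t - approx (Suc k) b t = glue (n b) (w b) f t"
  proof -
    have "approx (Suc (Suc k)) b t - approx (Suc k) b t
        = glue (n b) (w b) (\<lambda>i. zigzag (approx (Suc k) b) (approx (Suc k) (\<beta> b i))) t
          - glue (n b) (w b) (\<lambda>i. zigzag (approx k b) (approx k (\<beta> b i))) t"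
      by (simp only: approx.simps(2))
    moreover have "f = (\<lambda>i t. zigzag (approx (Suc k) b) (approx (Suc k) (\<beta> b i)) t
      - zigzag (approx k b) (approx k (\<beta> b i)) t)" by (intro ext) (rule f_def)
    ultimately show ?thesis by (simp only: glue_diff)
  qed
  have bump: "bump (f i)" and bound: "norm (f i t) \<le> (1/2) * D" if i: "i < n b" for i t
  proof -
    note \<beta> = \<beta>_B[OF Suc.prems i]
    note curves = approx_curve[OF Suc.prems] approx_curve[OF \<beta>]
    note zz = curve_zigzag[OF linear_\<phi> curves]
    show "bump (f i)" unfolding f_def by (rule bump_curve_diff[OF zz zz])
    have "norm (glue 2 (\<lambda>_. 1/2) (\<lambda>j. if j = 0 then (\<lambda>t. approx (Suc k) b t - approx k b t)
        else (\<lambda>t. approx (Suc k) (\<beta> b i) t - approx k (\<beta> b i) t)) t) \<le> (1/2) * D"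
    proof (rule glue_bump_bound)
      show "bump (if j = 0 then (\<lambda>t. approx (Suc k) b t - approx k b t)
        else (\<lambda>t. approx (Suc k) (\<beta> b i) t - approx k (\<beta> b i) t))" for j :: nat
        using bump_curve_diff[OF curves(1) curves(1)] bump_curve_diff[OF curves(2) curves(2)]
        by (cases j) (simp_all del: approx.simps)
      show "norm ((if j = 0 then (\<lambda>t. approx (Suc k) b t - approx k b t)
        else (\<lambda>t. approx (Suc k) (\<beta> b i) t - approx k (\<beta> b i) t)) t) \<le> D" for j :: nat and t
        using Suc.IH[OF Suc.prems] Suc.IH[OF \<beta>] unfolding D_def
        by (cases j) (simp_all del: approx.simps)
    qed (use D in auto)
    then show "norm (f i t) \<le> (1/2) * D" unfolding f_def zigzag_diff .
  qed
  have "norm (glue (n b) (w b) f t) \<le> 1 * ((1/2) * D)"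
    by (rule glue_bump_bound) (use w_nonneg[OF Suc.prems] w_le_1[OF Suc.prems] bump bound D in auto)
  then show ?case unfolding diff by (simp add: D_def)
qed

lemma curve_limit:
  assumes "\<And>k. curve \<phi> C b (g k)" "\<And>t. (\<lambda>k. g k t) \<longlonglongrightarrow> h t"
  shows "curve \<phi> C b h"
proof -
  have "h 0 = 0" using assms(2)[of 0] assms(1) by (simp add: curve_def LIMSEQ_const_iff)
  moreover have "h 1 = b" using assms(2)[of 1] assms(1) by (simp add: curve_def LIMSEQ_const_iff)
  moreover have "\<phi> (h t) = ramp t" for t
    using bounded_linear.tendsto[OF \<phi> assms(2)[of t]] assms(1) by (simp add: curve_def LIMSEQ_const_iff)
  moreover have "norm (h t - h s) \<le> C * (ramp t - ramp s)" if "s \<le> t" for s t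
  proof (rule tendsto_upperbound)
    show "(\<lambda>k. norm (g k t - g k s)) \<longlonglongrightarrow> norm (h t - h s)" by (intro tendsto_intros assms(2))
    show "\<forall>\<^sub>F k in sequentially. norm (g k t - g k s) \<le> C * (ramp t - ramp s)"
      using assms(1) that by (simp add: curve_def)
  qed simp
  ultimately show ?thesis unfolding curve_def by blast
qed

text \<open>
  The limits of the approximations are a fixed point of the iteration, and so they branch by coinduction.
\<close>

lemma branching_exists:
  assumes "b \<in> B" shows "\<exists>g. branching b g"
proof -
  define G where "G b t = lim (\<lambda>k. approx k b t)" for b t
  have lim: "(\<lambda>k. approx k b t) \<longlonglongrightarrow> G b t" if b: "b \<in> B" for b t
  proof -
    have "summable (\<lambda>k. 2 * \<bar>C\<bar> * (1/2) ^ k)" by (intro summable_mult summable_geometric) simp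
    then have "summable (\<lambda>k. norm (approx (Suc k) b t - approx k b t))"
      by (rule summable_comparison_test'[where N=0]) (use approx_step[OF b] in \<open>simp del: approx.simps\<close>)
    then have "summable (\<lambda>k. approx (Suc k) b t - approx k b t)" by (rule summable_norm_cancel)
    then have "convergent (\<lambda>m. \<Sum>k<m. approx (Suc k) b t - approx k b t)" by (simp add: summable_iff_convergent)
    then have "convergent (\<lambda>m. approx m b t - approx 0 b t)" by (simp add: sum_lessThan_telescope[of "\<lambda>k. approx k b t"] del: approx.simps)
    then have "convergent (\<lambda>m. (approx m b t - approx 0 b t) + approx 0 b t)" by (intro convergent_add convergent_const)
    then show ?thesis by (simp add: G_def convergent_LIMSEQ_iff del: approx.simps)
  qed
  have fix_eq: "G b = glue (n b) (w b) (\<lambda>i. zigzag (G b) (G (\<beta> b i)))" if b: "b \<in> B" for b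
  proof
    fix t
    have "(\<lambda>k. approx (Suc k) b t) \<longlonglongrightarrow> glue (n b) (w b) (\<lambda>i. zigzag (G b) (G (\<beta> b i))) t"
      unfolding approx.simps glue_def zigzag_def
      by (intro tendsto_sum tendsto_scaleR tendsto_const) (auto intro: lim b \<beta>_B)
    moreover have "(\<lambda>k. approx (Suc k) b t) \<longlonglongrightarrow> G b t" using lim[OF b] by (rule LIMSEQ_Suc)
    ultimately show "G b t = glue (n b) (w b) (\<lambda>i. zigzag (G b) (G (\<beta> b i))) t"
      using LIMSEQ_unique by blast
  qed
  have curve_G: "curve \<phi> C b (G b)" if "b \<in> B" for b
    using curve_limit[OF approx_curve[OF that] lim[OF that]] .
  have "branching b (G b)"
  proof (rule branching.coinduct[where X="\<lambda>b g. b \<in> B \<and> g = G b"])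
    fix b g assume "b \<in> B \<and> g = G b"
    then have b: "b \<in> B" and g: "g = G b" by auto
    let ?k = "\<lambda>i. zigzag (G b) (G (\<beta> b i))"
    have "\<exists>g h. ((b \<in> B \<and> g = G b) \<or> branching b g) \<and> ((\<beta> b i \<in> B \<and> h = G (\<beta> b i)) \<or> branching (\<beta> b i) h)
        \<and> (?k i = zigzag g h \<or> ?k i = zigzag h g)" if "i < n b" for i
      using b \<beta>_B[OF b that] by blast
    moreover have "curve \<phi> C b (glue (n b) (w b) ?k)" using curve_G[OF b] fix_eq[OF b] by simp
    moreover have "g = glue (n b) (w b) ?k" using g fix_eq[OF b] by simp
    ultimately show "\<exists>b' k. b = b' \<and> g = glue (n b') (w b') k \<and> b' \<in> B \<and> curve \<phi> C b' (glue (n b') (w b') k) \<and>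
        (\<forall>i. i < n b' \<longrightarrow> (\<exists>g h. ((b' \<in> B \<and> g = G b') \<or> branching b' g) \<and> ((\<beta> b' i \<in> B \<and> h = G (\<beta> b' i)) \<or> branching (\<beta> b' i) h)
          \<and> (k i = zigzag g h \<or> k i = zigzag h g)))"
      using b by (intro exI[of _ b] exI[of _ ?k]) blast
  qed (use assms in simp)
  then show ?thesis by blast
qed

text \<open>
  Exchange the two halves of every zigzag on the coarsest scale. The break points stay, and the midpoint of
  the \<open>i\<close>-th zigzag, before scaling by \<open>w b i\<close>, moves by \<open>norm (b - \<beta> b i) / 2\<close>.
\<close>

lemma swap_deviates:
  assumes "branching b g" "Q \<subseteq> {0, 1}"
  shows "\<exists>h. branching b h \<and> deviates (\<lambda>t. g t - h t) 0 1 Q (\<delta> / 2)"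
  using assms(1)
proof cases
  case (node k)
  note b = node(2)
  have "\<forall>i\<in>{..<n b}. \<exists>k'. (\<exists>g h. branching b g \<and> branching (\<beta> b i) h \<and> (k' = zigzag g h \<or> k' = zigzag h g)) \<and>
      bump (\<lambda>t. k i t - k' t) \<and> deviates (\<lambda>t. k i t - k' t) 0 1 {0, 1} (norm (b - \<beta> b i) / 2)"
  proof
    fix i assume "i \<in> {..<n b}"
    then have i: "i < n b" by simp
    obtain g h where gh: "branching b g" "branching (\<beta> b i) h" "k i = zigzag g h \<or> k i = zigzag h g"
      using node(4)[OF i] by blast
    note c = branching_curve[OF gh(1)] branching_curve[OF gh(2)]
    have half: "zigzag g h (1/2) - zigzag h g (1/2) = (1/2) *\<^sub>R (b - \<beta> b i)"
      using c by (simp add: zigzag_def glue_def numeral_2_eq_2 curve_def scaleR_diff_right)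
    have z: "curve \<phi> C ((1/2) *\<^sub>R (b + \<beta> b i)) (zigzag g h)" "curve \<phi> C ((1/2) *\<^sub>R (b + \<beta> b i)) (zigzag h g)"
      using curve_zigzag[OF linear_\<phi> c(1,2)] curve_zigzag[OF linear_\<phi> c(2,1)] by (auto simp: add.commute)
    have "deviates (\<lambda>t. zigzag g h t - zigzag h g t) 0 1 {0, 1} (norm (zigzag g h (1/2) - zigzag h g (1/2)))"
      by (rule deviates_once) (use z in \<open>auto simp: curve_def\<close>)
    then have 1: "deviates (\<lambda>t. zigzag g h t - zigzag h g t) 0 1 {0, 1} (norm (b - \<beta> b i) / 2)"
      by (simp add: half)
    have "deviates (\<lambda>t. zigzag h g t - zigzag g h t) 0 1 {0, 1} (norm (zigzag h g (1/2) - zigzag g h (1/2)))"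
      by (rule deviates_once) (use z in \<open>auto simp: curve_def\<close>)
    then have 2: "deviates (\<lambda>t. zigzag h g t - zigzag g h t) 0 1 {0, 1} (norm (b - \<beta> b i) / 2)"
      by (subst (asm) norm_minus_commute) (simp add: half)
    show "\<exists>k'. (\<exists>g h. branching b g \<and> branching (\<beta> b i) h \<and> (k' = zigzag g h \<or> k' = zigzag h g)) \<and>
      bump (\<lambda>t. k i t - k' t) \<and> deviates (\<lambda>t. k i t - k' t) 0 1 {0, 1} (norm (b - \<beta> b i) / 2)"
      using gh(3)
    proof
      assume "k i = zigzag g h"
      then show ?thesis using gh(1,2) 1 bump_curve_diff[OF z(1,2)] by (intro exI[of _ "zigzag h g"]) auto
    next
      assume "k i = zigzag h g"
      then show ?thesis using gh(1,2) 2 bump_curve_diff[OF z(2,1)] by (intro exI[of _ "zigzag g h"]) auto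
    qed
  qed
  from bchoice[OF this] obtain k' where k': "\<And>i. i < n b \<Longrightarrow> \<exists>g h. branching b g \<and> branching (\<beta> b i) h \<and> (k' i = zigzag g h \<or> k' i = zigzag h g)"
      "\<And>i. i < n b \<Longrightarrow> bump (\<lambda>t. k i t - k' i t)"
      "\<And>i. i < n b \<Longrightarrow> deviates (\<lambda>t. k i t - k' i t) 0 1 {0, 1} (norm (b - \<beta> b i) / 2)"
    by fastforce
  have h: "branching b (glue (n b) (w b) k')" by (rule branching_glue[OF b k'(1)])
  let ?U = "\<Union>j<n b. (\<lambda>u. sum (w b) {..<j} + w b j * u) ` {0, 1}"
  have "deviates (glue (n b) (w b) (\<lambda>i t. k i t - k' i t)) 0 (sum (w b) {..<n b}) ?U
      (\<Sum>j<n b. w b j * (norm (b - \<beta> b j) / 2))"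
    by (rule deviates_glue[where N="n b"]) (use w_nonneg[OF b] k'(2,3) in auto)
  then have dev: "deviates (\<lambda>t. g t - glue (n b) (w b) k' t) 0 1 ?U (\<Sum>j<n b. w b j * (norm (b - \<beta> b j) / 2))"
    unfolding node(1) glue_diff w_sum[OF b] .
  have "Q \<subseteq> ?U"
  proof -
    obtain m where m: "n b = Suc m" using w_sum[OF b] by (cases "n b") auto
    have "0 \<in> ?U" by (rule UN_I[of 0]) (use m in auto)
    moreover have "1 \<in> ?U" by (rule UN_I[of m]) (use m w_sum[OF b] in auto)
    ultimately show ?thesis using assms(2) by blast
  qed
  moreover have "\<delta> / 2 \<le> (\<Sum>j<n b. w b j * (norm (b - \<beta> b j) / 2))"
    using spread[OF b] by (simp add: sum_divide_distrib[symmetric])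
  ultimately have "deviates (\<lambda>t. g t - glue (n b) (w b) k' t) 0 1 Q (\<delta> / 2)" using deviates_mono[OF dev] by blast
  with h show ?thesis by blast
qed

text \<open>
  The induction descends \<open>k\<close> scales, and each halving of the lengths halves the part of the bound that the
  prescribed points cost. On the last scale, \<open>k = 0\<close>, the zigzags of a piece are exchanged if no prescribed
  point lies in its interior; otherwise the claimed bound is not positive and the piece is left unchanged.
\<close>

lemma branching_deviates:
  assumes "branching b g" "finite Q" "Q \<subseteq> {0..1}"
  shows "\<exists>h. branching b h \<and>
    deviates (\<lambda>t. g t - h t) 0 1 Q (\<delta> / 2 * (1 - (1/2) ^ k * card (Q \<inter> {0<..<1})))"
  using assms
proof (induction k arbitrary: b g Q)
  case 0
  show ?case
  proof (cases "Q \<inter> {0<..<1} = {}")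
    case True
    then have "Q \<subseteq> {0, 1}" using 0(3) by force
    with swap_deviates[OF 0(1)] True show ?thesis by simp
  next
    case False
    then have "1 \<le> card (Q \<inter> {0<..<1})" using 0(2) by (simp add: Suc_le_eq card_gt_0_iff)
    then have "\<delta> / 2 * (1 - (1/2) ^ 0 * card (Q \<inter> {0<..<1})) \<le> 0"
      using \<delta>_pos by (simp add: mult_nonneg_nonpos)
    then have "deviates (\<lambda>t. g t - g t) 0 1 Q (\<delta> / 2 * (1 - (1/2) ^ 0 * card (Q \<inter> {0<..<1})))"
      using deviates_zero[OF 0(2,3)] by (auto elim: deviates_mono)
    then show ?thesis using 0(1) by blast
  qed
next
  case (Suc k)
  let ?A = "\<lambda>Q k. \<delta> / 2 * (1 - (1/2) ^ k * card (Q \<inter> {0<..<1}))"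
  have zig: "\<exists>h1 h2. branching b1 h1 \<and> branching b2 h2 \<and> bump (\<lambda>t. zigzag g1 g2 t - zigzag h1 h2 t) \<and>
      deviates (\<lambda>t. zigzag g1 g2 t - zigzag h1 h2 t) 0 1 Q (?A Q (Suc k))"
    if g: "branching b1 g1" "branching b2 g2" and Q: "finite Q" "Q \<subseteq> {0..1}" for b1 b2 g1 g2 Q
  proof -
    have loc: "finite (localize (\<lambda>_. 1/2) j Q)" "localize (\<lambda>_. 1/2) j Q \<subseteq> {0..1}" for j
      using Q by (auto simp: localize_def)
    obtain h1 where h1: "branching b1 h1" "deviates (\<lambda>t. g1 t - h1 t) 0 1 (localize (\<lambda>_. 1/2) 0 Q) (?A (localize (\<lambda>_. 1/2) 0 Q) k)"
      using Suc.IH[OF g(1) loc] by blast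
    obtain h2 where h2: "branching b2 h2" "deviates (\<lambda>t. g2 t - h2 t) 0 1 (localize (\<lambda>_. 1/2) 1 Q) (?A (localize (\<lambda>_. 1/2) 1 Q) k)"
      using Suc.IH[OF g(2) loc] by blast
    note c1 = branching_curve[OF g(1)] branching_curve[OF h1(1)]
    note c2 = branching_curve[OF g(2)] branching_curve[OF h2(1)]
    have "deviates (glue 2 (\<lambda>_. 1/2) (\<lambda>j. if j = 0 then (\<lambda>t. g1 t - h1 t) else (\<lambda>t. g2 t - h2 t))) 0 1 Q
      (\<delta> / 2 * (1 - (1/2) ^ k * (1/2) * card (Q \<inter> {0<..<1})))"
      by (rule deviates_glue_count)
        (use Q h1 h2 bump_curve_diff[OF c1] bump_curve_diff[OF c2] \<delta>_pos in \<open>auto simp: less_2_cases_iff\<close>)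
    then have "deviates (\<lambda>t. zigzag g1 g2 t - zigzag h1 h2 t) 0 1 Q (?A Q (Suc k))"
      unfolding zigzag_diff by (simp add: mult.commute)
    moreover have "bump (\<lambda>t. zigzag g1 g2 t - zigzag h1 h2 t)"
      by (rule bump_curve_diff[OF curve_zigzag[OF linear_\<phi> c1(1) c2(1)] curve_zigzag[OF linear_\<phi> c1(2) c2(2)]])
    ultimately show ?thesis using h1 h2 by blast
  qed
  from Suc.prems(1) show ?case
  proof cases
    case (node kk)
    note b = node(2)
    let ?L = "\<lambda>i. localize (w b) i Q"
    have loc: "finite (?L i)" "?L i \<subseteq> {0..1}" if "i < n b" for i
      using Suc.prems localize_unit[where w="w b", OF w_nonneg[OF b that]] by (auto simp: localize_def)
    have "\<forall>i\<in>{..<n b}. \<exists>k'. (\<exists>g h. branching b g \<and> branching (\<beta> b i) h \<and> (k' = zigzag g h \<or> k' = zigzag h g)) \<and>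
        bump (\<lambda>t. kk i t - k' t) \<and> deviates (\<lambda>t. kk i t - k' t) 0 1 (?L i) (?A (?L i) (Suc k))"
    proof
      fix i assume "i \<in> {..<n b}"
      then have i: "i < n b" by simp
      obtain g h where gh: "branching b g" "branching (\<beta> b i) h" "kk i = zigzag g h \<or> kk i = zigzag h g"
        using node(4)[OF i] by blast
      show "\<exists>k'. (\<exists>g h. branching b g \<and> branching (\<beta> b i) h \<and> (k' = zigzag g h \<or> k' = zigzag h g)) \<and>
        bump (\<lambda>t. kk i t - k' t) \<and> deviates (\<lambda>t. kk i t - k' t) 0 1 (?L i) (?A (?L i) (Suc k))"
        using gh(3)
      proof
        assume kk: "kk i = zigzag g h"
        obtain h1 h2 where "branching b h1" "branching (\<beta> b i) h2" "bump (\<lambda>t. zigzag g h t - zigzag h1 h2 t)"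
            "deviates (\<lambda>t. zigzag g h t - zigzag h1 h2 t) 0 1 (?L i) (?A (?L i) (Suc k))"
          using zig[OF gh(1,2) loc[OF i]] by blast
        then show ?thesis unfolding kk by (intro exI[of _ "zigzag h1 h2"]) blast
      next
        assume kk: "kk i = zigzag h g"
        obtain h1 h2 where "branching (\<beta> b i) h1" "branching b h2" "bump (\<lambda>t. zigzag h g t - zigzag h1 h2 t)"
            "deviates (\<lambda>t. zigzag h g t - zigzag h1 h2 t) 0 1 (?L i) (?A (?L i) (Suc k))"
          using zig[OF gh(2,1) loc[OF i]] by blast
        then show ?thesis unfolding kk by (intro exI[of _ "zigzag h1 h2"]) blast
      qed
    qed
    from bchoice[OF this] obtain k' where k': "\<And>i. i < n b \<Longrightarrow> \<exists>g h. branching b g \<and> branching (\<beta> b i) h \<and> (k' i = zigzag g h \<or> k' i = zigzag h g)"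
        "\<And>i. i < n b \<Longrightarrow> bump (\<lambda>t. kk i t - k' i t)"
        "\<And>i. i < n b \<Longrightarrow> deviates (\<lambda>t. kk i t - k' i t) 0 1 (?L i) (?A (?L i) (Suc k))"
      by fastforce
    have "deviates (glue (n b) (w b) (\<lambda>i t. kk i t - k' i t)) 0 1 Q
        (\<delta> / 2 * (1 - (1/2) ^ Suc k * 1 * card (Q \<inter> {0<..<1})))"
      by (rule deviates_glue_count)
        (use w_nonneg[OF b] w_sum[OF b] w_le_1[OF b] k'(2,3) Suc.prems \<delta>_pos in auto)
    then have "deviates (\<lambda>t. g t - glue (n b) (w b) k' t) 0 1 Q (?A Q (Suc k))"
      unfolding node(1) glue_diff by simp
    then show ?thesis using branching_glue[OF b k'(1)] by blast
  qed
qed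

text \<open>
  Along a curve the first term is elapsed time and the second is at most that. The second term makes
  the metric equivalent to the norm.
\<close>

definition bush_dist :: "'x \<Rightarrow> 'x \<Rightarrow> real" where
  "bush_dist x y = max \<bar>\<phi> (x - y)\<bar> (norm (x - y) / C)"

lemma C_pos: "b \<in> B \<Longrightarrow> 0 < C"
proof -
  assume b: "b \<in> B"
  have "b \<noteq> 0" using \<phi>_B[OF b] linear_0[OF linear_\<phi>] by auto
  then show "0 < C" using norm_B[OF b] by (meson less_le_trans zero_less_norm_iff)
qed

lemma metric_bush_dist:
  assumes "b \<in> B" shows "Metric_space UNIV bush_dist"
proof
  note C = C_pos[OF assms]
  fix x y z :: 'x
  show "0 \<le> bush_dist x y" by (simp add: bush_dist_def)
  have "\<bar>\<phi> (x - y)\<bar> = \<bar>\<phi> (y - x)\<bar>" using linear_diff[OF linear_\<phi>] by (metis abs_minus_commute)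
  then show "bush_dist x y = bush_dist y x" by (simp add: bush_dist_def norm_minus_commute)
  show "bush_dist x y = 0 \<longleftrightarrow> x = y"
  proof
    assume "bush_dist x y = 0"
    moreover have "norm (x - y) / C \<le> bush_dist x y" by (simp add: bush_dist_def)
    ultimately show "x = y" using C by (simp add: divide_le_0_iff)
  qed (simp add: bush_dist_def linear_0[OF linear_\<phi>])
  show "bush_dist x z \<le> bush_dist x y + bush_dist y z"
  proof -
    have "\<phi> (x - z) = \<phi> (x - y) + \<phi> (y - z)" using linear_add[OF linear_\<phi>, of "x - y" "y - z"] by simp
    then have "\<bar>\<phi> (x - z)\<bar> \<le> \<bar>\<phi> (x - y)\<bar> + \<bar>\<phi> (y - z)\<bar>" by linarith
    moreover have "norm (x - z) / C \<le> norm (x - y) / C + norm (y - z) / C"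
      using norm_triangle_ineq[of "x - y" "y - z"] C by (simp add: add_divide_distrib[symmetric] divide_right_mono)
    ultimately show ?thesis unfolding bush_dist_def by (smt (verit) max.cobounded1 max.cobounded2)
  qed
qed

lemma bilipschitz_bush_dist:
  assumes "b \<in> B" shows "bilipschitz_embedding UNIV bush_dist (\<lambda>x. x)"
proof -
  note C = C_pos[OF assms]
  obtain K where K: "K > 0" "\<And>x. norm (\<phi> x) \<le> norm x * K"
    using bounded_linear.pos_bounded[OF \<phi>] by blast
  define c where "c = min C (1 / (K + 1 / C))"
  have c: "0 < c" "c \<le> C" "c * (K + 1 / C) \<le> 1"
  proof -
    have "0 < K + 1 / C" using C K by (simp add: add_pos_pos)
    then show "0 < c" "c \<le> C" using C by (auto simp: c_def)
    have "c \<le> 1 / (K + 1 / C)" by (simp add: c_def)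
    then show "c * (K + 1 / C) \<le> 1" using \<open>0 < K + 1 / C\<close> by (simp add: pos_le_divide_eq)
  qed
  have "c * bush_dist x y \<le> norm (x - y)" for x y
  proof -
    have "bush_dist x y \<le> (K + 1 / C) * norm (x - y)"
    proof -
      have "\<bar>\<phi> (x - y)\<bar> \<le> K * norm (x - y)" using K(2)[of "x - y"] by (simp add: mult.commute)
      moreover have "0 \<le> norm (x - y) / C" "0 \<le> K * norm (x - y)" using C K(1) by auto
      moreover have "(K + 1 / C) * norm (x - y) = K * norm (x - y) + norm (x - y) / C" by (simp add: algebra_simps)
      ultimately show ?thesis unfolding bush_dist_def by linarith
    qed
    then have "c * bush_dist x y \<le> c * ((K + 1 / C) * norm (x - y))" using c by (intro mult_left_mono) auto
    also have "\<dots> = (c * (K + 1 / C)) * norm (x - y)" by (simp only: mult.assoc)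
    also have "\<dots> \<le> 1 * norm (x - y)" using c by (intro mult_right_mono) auto
    finally show ?thesis by simp
  qed
  moreover have "norm (x - y) \<le> C * bush_dist x y" for x y
  proof -
    have "norm (x - y) / C \<le> bush_dist x y" by (simp add: bush_dist_def)
    then show ?thesis using C by (simp add: divide_le_eq mult.commute)
  qed
  ultimately show ?thesis unfolding bilipschitz_embedding_def using c by blast
qed

lemma geodesic_curve:
  assumes b: "b \<in> B" and g: "curve \<phi> C b g"
  shows "geodesic UNIV bush_dist 0 b g" and "bush_dist 0 b = 1"
proof -
  note C = C_pos[OF b]
  have neg: "\<phi> (- x) = - \<phi> x" for x by (rule linear_neg[OF linear_\<phi>])
  show 1: "bush_dist 0 b = 1"
    using \<phi>_B[OF b] norm_B[OF b] C by (simp add: bush_dist_def neg max_def)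
  have *: "bush_dist (g t) (g s) = \<bar>t - s\<bar>" if "s \<le> t" "0 \<le> s" "t \<le> 1" for s t
  proof -
    have "\<phi> (g t - g s) = t - s"
      using g that linear_diff[OF linear_\<phi>] by (simp add: curve_def ramp_def)
    moreover have "norm (g t - g s) \<le> C * (ramp t - ramp s)" using g that unfolding curve_def by blast
    then have "norm (g t - g s) / C \<le> t - s" using that C by (simp add: ramp_def divide_le_eq mult.commute)
    ultimately show ?thesis using that by (simp add: bush_dist_def)
  qed
  have "bush_dist (g s) (g t) = \<bar>s - t\<bar>" if "s \<in> {0..1}" "t \<in> {0..1}" for s t
  proof (cases "s \<le> t")
    case True
    then show ?thesis using * that Metric_space.commute[OF metric_bush_dist[OF b], of "g s" "g t"] by (auto simp: abs_minus_commute)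
  next
    case False then show ?thesis using * that by simp
  qed
  then show "geodesic UNIV bush_dist 0 b g" unfolding geodesic_def 1 using g by (auto simp: curve_def)
qed

text \<open>
  By \<open>branching_deviates\<close>, on a fine scale the prescribed points cost at most half of \<open>\<delta> / 2\<close>; the factor
  \<open>1 / C\<close> converts the norm into the metric.
\<close>

lemma thick_family_branching:
  assumes b: "b \<in> B"
  shows "thick_family UNIV bush_dist 0 b {g. branching b g}"
  unfolding thick_family_def
proof (intro conjI ballI exI[of _ "\<delta> / 4 / C"] allI impI)
  note C = C_pos[OF b]
  show "0 < \<delta> / 4 / C" using C \<delta>_pos by simp
  fix g assume "g \<in> {g. branching b g}"
  then have g: "branching b g" by simp
  then show "geodesic UNIV bush_dist 0 b g" using geodesic_curve[OF b] branching_curve by blast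
  have 1: "bush_dist 0 b = 1" using geodesic_curve(2)[OF b branching_curve[OF g]] .
  fix N :: nat and r :: "nat \<Rightarrow> 'x"
  assume "\<forall>i\<in>{1..N}. r i \<in> g ` {0..bush_dist 0 b}"
  then have "\<forall>i\<in>{1..N}. \<exists>t. t \<in> {0..1} \<and> r i = g t" unfolding 1 by blast
  then obtain t where t: "\<And>i. i \<in> {1..N} \<Longrightarrow> t i \<in> {0..1} \<and> r i = g (t i)" using bchoice by metis
  define Q where "Q = t ` {1..N}"
  have Q: "finite Q" "Q \<subseteq> {0..1}" using t by (auto simp: Q_def)
  obtain k :: nat where k: "(1/2) ^ k * real (card (Q \<inter> {0<..<1})) \<le> 1/2"
  proof -
    obtain k :: nat where k: "2 * real (card (Q \<inter> {0<..<1})) \<le> 2 ^ k"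
      by (metis less_imp_le real_arch_pow one_less_numeral_iff semiring_norm(76))
    show ?thesis by (rule that[of k]) (use k in \<open>simp add: power_divide divide_simps\<close>)
  qed
  obtain h where h: "branching b h"
      "deviates (\<lambda>t. g t - h t) 0 1 Q (\<delta> / 2 * (1 - (1/2) ^ k * card (Q \<inter> {0<..<1})))"
    using branching_deviates[OF g Q] by blast
  have "\<delta> / 4 \<le> \<delta> / 2 * (1 - (1/2) ^ k * card (Q \<inter> {0<..<1}))"
    using mult_left_mono[of "1/2" "1 - (1/2) ^ k * real (card (Q \<inter> {0<..<1}))" "\<delta> / 2"] k \<delta>_pos by simp
  then have dev: "deviates (\<lambda>t. g t - h t) 0 1 Q (\<delta> / 4)" using deviates_mono[OF h(2)] by blast
  then obtain m q s where q: "q 0 = 0" "q m = 1" "\<And>i. i < m \<Longrightarrow> q i \<le> s i \<and> s i \<le> q (Suc i)"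
      "\<And>i. i \<le> m \<Longrightarrow> g (q i) - h (q i) = 0" "Q \<subseteq> q ` {..m}" "\<delta> / 4 \<le> (\<Sum>i<m. norm (g (s i) - h (s i)))"
    unfolding deviates_def by blast
  \<comment> \<open>thickness counts from 1 and requires an \<open>s\<close> also before the first and after the last \<open>q\<close>: 0 and 1 are added, with no deviation\<close>
  define q' where "q' i = q (i - 1)" for i
  define s' where "s' i = (if i = 1 then 0 else if i = m + 2 then 1 else s (i - 2))" for i
  have chain: "s' i \<le> q' i \<and> q' i \<le> s' (i + 1)" if i: "i \<in> {1..m+1}" for i
  proof
    show "s' i \<le> q' i"
    proof (cases "i = 1")
      case False
      then have "i - 2 < m" "Suc (i - 2) = i - 1" using i by auto
      then show ?thesis using q(3)[of "i - 2"] False i by (simp add: s'_def q'_def)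
    qed (simp add: s'_def q'_def q(1))
    show "q' i \<le> s' (i + 1)"
    proof (cases "i = m + 1")
      case False
      then have "i - 1 < m" using i by auto
      then show ?thesis using q(3)[of "i - 1"] False i by (auto simp: s'_def q'_def)
    qed (simp add: s'_def q'_def q(2))
  qed
  have t_ok: "t i \<in> {0..bush_dist 0 b} \<and> r i = g (t i) \<and> r i = h (t i)" if i: "i \<in> {1..N}" for i
    using t[OF i] deviates_eq_0[OF dev, of "t i"] i by (auto simp: 1 Q_def)
  have cover: "t ` {1..N} \<subseteq> q' ` {1..m+1}"
  proof -
    have "q ` {..m} \<subseteq> q' ` {1..m+1}"
    proof (safe)
      fix i assume "i \<le> m"
      then show "q i \<in> q' ` {1..m+1}" by (intro image_eqI[of _ _ "Suc i"]) (auto simp: q'_def)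
    qed
    then show ?thesis using q(5) by (auto simp: Q_def)
  qed
  have meet: "g (q' i) = h (q' i)" if "i \<in> {1..m+1}" for i using q(4)[of "i - 1"] that by (auto simp: q'_def)
  have big: "\<delta> / 4 / C \<le> (\<Sum>i=1..m+1+1. bush_dist (g (s' i)) (h (s' i)))"
  proof -
    have le: "norm (x - y) / C \<le> bush_dist x y" and nonneg: "0 \<le> bush_dist x y" for x y by (simp_all add: bush_dist_def)
    have "\<delta> / 4 / C \<le> (\<Sum>i<m. norm (g (s i) - h (s i)) / C)"
      using q(6) C by (simp add: sum_divide_distrib[symmetric] divide_right_mono del: divide_divide_eq_left)
    also have "\<dots> \<le> (\<Sum>i<m. bush_dist (g (s i)) (h (s i)))" by (intro sum_mono le)
    also have "\<dots> = (\<Sum>i<m. bush_dist (g (s' (i + 2))) (h (s' (i + 2))))"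
      by (intro sum.cong) (auto simp: s'_def)
    also have "\<dots> = (\<Sum>i\<in>(\<lambda>i. i + 2) ` {..<m}. bush_dist (g (s' i)) (h (s' i)))"
      by (subst sum.reindex) (auto simp: inj_on_def)
    also have "\<dots> \<le> (\<Sum>i=1..m+1+1. bush_dist (g (s' i)) (h (s' i)))"
      by (intro sum_mono2) (auto simp: nonneg)
    finally show ?thesis .
  qed
  have ends: "0 \<le> s' 1" "s' (m + 1 + 1) \<le> bush_dist 0 b" by (simp_all add: s'_def 1)
  show "\<exists>h\<in>{g. branching b g}. \<exists>(t :: nat \<Rightarrow> real) (m::nat) (q :: nat \<Rightarrow> real) (s :: nat \<Rightarrow> real).
      (\<forall>i\<in>{1..N}. t i \<in> {0..bush_dist 0 b} \<and> r i = g (t i) \<and> r i = h (t i)) \<and> t ` {1..N} \<subseteq> q ` {1..m} \<and>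
      0 \<le> s 1 \<and> (\<forall>i\<in>{1..m}. s i \<le> q i \<and> q i \<le> s (i + 1)) \<and> s (m + 1) \<le> bush_dist 0 b \<and>
      (\<forall>i\<in>{1..m}. g (q i) = h (q i)) \<and> \<delta> / 4 / C \<le> (\<Sum>i=1..m+1. bush_dist (g (s i)) (h (s i)))"
  proof (rule bexI[of _ h], rule exI[of _ t], rule exI[of _ "m + 1"], rule exI[of _ q'], rule exI[of _ s'], intro conjI ballI)
    fix i assume i: "i \<in> {1..N}"
    show "t i \<in> {0..bush_dist 0 b}" "r i = g (t i)" "r i = h (t i)" using t_ok[OF i] by blast+
  qed (use h(1) cover ends chain meet big in simp_all)
qed

lemma thick_family_exists:
  assumes b: "b \<in> B"
  shows "\<exists>(M :: 'x set) d u v T. Metric_space M d \<and> u \<in> M \<and> v \<in> M \<and> T \<noteq> {} \<and>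
    thick_family M d u v T \<and> (\<exists>f :: 'x \<Rightarrow> 'x. bilipschitz_embedding M d f)"
proof -
  have "{g. branching b g} \<noteq> {}" using branching_exists[OF b] by blast
  then show ?thesis
    using metric_bush_dist[OF b] bilipschitz_bush_dist[OF b] thick_family_branching[OF b] by blast
qed

end

section \<open>A bush in a space without the Radon-Nikodym property\<close>

context vector_measure
begin

text \<open>
  Subtracting \<open>\<phi> y *\<^sub>R x0\<close> from the averages \<open>y\<close> and adding \<open>x0\<close> keeps convex combinations and puts all of
  them on \<open>\<phi> = 1\<close>. It could destroy the oscillation if this took place in the direction \<open>x0\<close>; therefore
  the measure is restricted beforehand to a set where \<open>\<phi>\<close> is constant on averages up to \<open>\<epsilon> / 8\<close>.
\<close>

lemma bush_exists:
  assumes no_density: "\<not> (\<exists>f. \<forall>E\<in>sets M. has_strong_bochner_integral M (\<lambda>w. indicator E w *\<^sub>R f w) (\<nu> E))"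
  shows "\<exists>(\<phi> :: 'x \<Rightarrow> real) B C \<delta> n w \<beta>. bush \<phi> B C \<delta> n w \<beta> \<and> B \<noteq> {}"
proof -
  obtain \<epsilon> E0 where \<epsilon>: "0 < \<epsilon>" and E0: "E0 \<in> sets M" "0 < measure M E0"
    and not_flat: "\<And>F. F \<in> sets M \<Longrightarrow> F \<subseteq> E0 \<Longrightarrow> 0 < measure M F \<Longrightarrow> \<not> flat \<epsilon> F"
    using density_exists no_density by blast
  have osc: "\<exists>G\<in>sets M. G \<subseteq> E \<and> \<epsilon> * measure M G < norm (\<nu> G - measure M G *\<^sub>R avg E)"
    if "E \<in> sets M" "E \<subseteq> E0" "0 < measure M E" for E
    using not_flat[OF that] unfolding flat_def by (auto simp: not_le)
  obtain E1 C1 where E1: "E1 \<in> sets M" "E1 \<subseteq> E0" "0 < measure M E1"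
    and C1: "\<And>G. G \<in> sets M \<Longrightarrow> G \<subseteq> E1 \<Longrightarrow> norm (\<nu> G) \<le> C1 * measure M G"
    using locally_bounded[OF E0] by blast
  obtain x :: 'x where x: "x \<noteq> 0"
  proof -
    obtain G where "G \<in> sets M" "\<epsilon> * measure M G < norm (\<nu> G - measure M G *\<^sub>R avg E1)" using osc[OF E1] by blast
    moreover have "0 \<le> \<epsilon> * measure M G" using \<epsilon> by simp
    ultimately have "\<nu> G - measure M G *\<^sub>R avg E1 \<noteq> 0" by auto
    then show ?thesis by (rule that)
  qed
  obtain \<phi> :: "'x \<Rightarrow> real" where \<phi>: "bounded_linear \<phi>" and \<phi>x: "\<phi> x = norm x" using norming_functional_exists[OF x] by blast
  have lin: "linear \<phi>" using \<phi> by (rule bounded_linear.linear)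
  define x0 where "x0 = x /\<^sub>R norm x"
  have x0: "\<phi> x0 = 1" "norm x0 = 1" using x \<phi>x by (simp_all add: x0_def linear_scale[OF lin])
  obtain K where K: "0 < K" "\<And>y. norm (\<phi> y) \<le> norm y * K" using bounded_linear.pos_bounded[OF \<phi>] by blast
  \<comment> \<open>half of the oscillation \<open>\<epsilon> / 4\<close> that \<open>oscillating_split\<close> provides\<close>
  define \<eta> where "\<eta> = \<epsilon> / 8"
  have \<eta>: "0 < \<eta>" using \<epsilon> by (simp add: \<eta>_def)
  obtain F0 s where F0: "F0 \<in> sets M" "F0 \<subseteq> E1" "0 < measure M F0"
    and s: "\<And>G. G \<in> sets M \<Longrightarrow> G \<subseteq> F0 \<Longrightarrow> (s - \<eta>) * measure M G \<le> \<phi> (\<nu> G) \<and> \<phi> (\<nu> G) \<le> s * measure M G"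
    using functional_locally_constant[OF \<phi> E1(1,3) C1 \<eta>] by blast

  define L where "L y = y - \<phi> y *\<^sub>R x0" for y
  have linL: "linear L" unfolding L_def
    by (intro linear_compose_sub linear_id[unfolded id_def] bounded_linear.linear[OF bounded_linear_scaleR_const[OF \<phi>]])
  define c where "c F = L (avg F) + x0" for F
  have \<phi>c: "\<phi> (c F) = 1" for F using x0 by (simp add: c_def L_def linear_add[OF lin] linear_diff[OF lin] linear_scale[OF lin])
  define pos where "pos F \<longleftrightarrow> F \<in> sets M \<and> F \<subseteq> F0 \<and> 0 < measure M F" for F
  define B where "B = c ` {F. pos F}"
  define C where "C = C1 + C1 * K + 1"
  have measure_c: "measure M G *\<^sub>R c G = L (\<nu> G) + measure M G *\<^sub>R x0" if "pos G" for G
    using that by (simp add: c_def avg_def pos_def scaleR_add_right flip: linear_scale[OF linL])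
  have norm_c: "norm (c F) \<le> C" if F: "pos F" for F
  proof -
    have "norm (\<nu> F) \<le> C1 * measure M F" using C1 F F0(2) unfolding pos_def by blast
    then have a: "norm (avg F) \<le> C1" using F by (simp add: avg_def pos_def divide_simps mult.commute)
    have "norm (c F) \<le> norm (avg F) + norm (\<phi> (avg F) *\<^sub>R x0) + norm x0"
      unfolding c_def L_def by (meson add_mono norm_triangle_ineq norm_triangle_ineq4 order_refl order_trans)
    also have "\<dots> \<le> C1 + C1 * K + 1"
    proof (intro add_mono a)
      have "norm (\<phi> (avg F) *\<^sub>R x0) \<le> norm (avg F) * K" using K(2)[of "avg F"] x0(2) by simp
      also have "\<dots> \<le> C1 * K" using a K(1) by (simp add: mult_right_mono)
      finally show "norm (\<phi> (avg F) *\<^sub>R x0) \<le> C1 * K" .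
    qed (use x0(2) in simp)
    finally show ?thesis by (simp add: C_def)
  qed
  have split: "\<exists>(m::nat) w \<beta>. (\<forall>i<m. \<beta> i \<in> B \<and> 0 \<le> w i) \<and> sum w {..<m} = 1 \<and> (\<Sum>i<m. w i *\<^sub>R \<beta> i) = b \<and>
      \<epsilon> / 8 \<le> (\<Sum>i<m. w i * norm (b - \<beta> i))" if b: "b \<in> B" for b
  proof -
    obtain F where F: "b = c F" "pos F" using b by (auto simp: B_def)
    have F': "F \<in> sets M" "F \<subseteq> F0" "0 < measure M F" using F by (auto simp: pos_def)
    have oscF: "\<exists>G\<in>sets M. G \<subseteq> E \<and> \<epsilon> * measure M G < norm (\<nu> G - measure M G *\<^sub>R avg E)"
      if "E \<in> sets M" "E \<subseteq> F" "0 < measure M E" for E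
      using osc[of E] that F'(2) F0(2) E1(2) by blast
    obtain m :: nat and G :: "nat \<Rightarrow> 'w set" where G: "\<And>i. G i \<in> sets M" "\<And>i. G i \<subseteq> F" "(\<Sum>i<m. \<nu> (G i)) = \<nu> F"
        "(\<Sum>i<m. measure M (G i)) = measure M F"
        "\<epsilon> / 4 * measure M F \<le> (\<Sum>i<m. norm (\<nu> (G i) - measure M (G i) *\<^sub>R avg F))"
      using oscillating_split[OF F'(1,3) oscF \<epsilon>] by blast
    let ?\<mu> = "\<lambda>i. measure M (G i)"
    define w where "w i = ?\<mu> i / measure M F" for i
    \<comment> \<open>null pieces get weight 0, but still need some element of \<open>B\<close>\<close>
    define \<beta> where "\<beta> i = (if 0 < ?\<mu> i then c (G i) else b)" for i
    have posG: "pos (G i)" if "0 < ?\<mu> i" for i using G(1,2)[of i] F'(2) that unfolding pos_def by blast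
    have \<mu>\<beta>: "?\<mu> i *\<^sub>R \<beta> i = L (\<nu> (G i)) + ?\<mu> i *\<^sub>R x0" for i
    proof (cases "0 < ?\<mu> i")
      case True then show ?thesis using measure_c[OF posG[OF True]] by (simp add: \<beta>_def)
    next
      case False
      then have "?\<mu> i = 0" by (simp add: zero_less_measure_iff)
      then show ?thesis using nu_null[OF G(1)] linear_0[OF linL] by simp
    qed
    have "\<beta> i \<in> B" for i using b posG by (auto simp: \<beta>_def B_def)
    moreover have "0 \<le> w i" for i by (simp add: w_def)
    moreover have "sum w {..<m} = 1" using G(4) F'(3) by (simp add: w_def sum_divide_distrib[symmetric])
    moreover have "(\<Sum>i<m. w i *\<^sub>R \<beta> i) = b"
    proof -
      have "(\<Sum>i<m. ?\<mu> i *\<^sub>R \<beta> i) = L (\<Sum>i<m. \<nu> (G i)) + (\<Sum>i<m. ?\<mu> i) *\<^sub>R x0"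
        by (simp add: \<mu>\<beta> sum.distrib linear_sum[OF linL] scaleR_sum_left)
      also have "\<dots> = measure M F *\<^sub>R b" using measure_c[OF F(2)] G(3,4) F(1) by simp
      finally have "(\<Sum>i<m. ?\<mu> i *\<^sub>R \<beta> i) /\<^sub>R measure M F = b" using F'(3) by simp
      then show ?thesis by (simp add: w_def scaleR_sum_right divide_inverse mult.commute)
    qed
    moreover have "\<epsilon> / 8 \<le> (\<Sum>i<m. w i * norm (b - \<beta> i))"
    proof -
      let ?d = "\<lambda>i. \<nu> (G i) - ?\<mu> i *\<^sub>R avg F"
      have piece: "norm (?d i) - \<eta> * ?\<mu> i \<le> ?\<mu> i * norm (b - \<beta> i)" for i
      proof -
        have "(s - \<eta>) * ?\<mu> i \<le> \<phi> (\<nu> (G i))" "\<phi> (\<nu> (G i)) \<le> s * ?\<mu> i"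
          using s[OF G(1)] G(2) F'(2) by blast+
        moreover have "(s - \<eta>) * ?\<mu> i \<le> ?\<mu> i * \<phi> (avg F)" "?\<mu> i * \<phi> (avg F) \<le> s * ?\<mu> i"
        proof -
          have "s - \<eta> \<le> \<phi> (avg F)" "\<phi> (avg F) \<le> s"
            using s[OF F'(1,2)] F'(3) by (simp_all add: avg_def linear_scale[OF lin] divide_simps mult.commute)
          then show "(s - \<eta>) * ?\<mu> i \<le> ?\<mu> i * \<phi> (avg F)" "?\<mu> i * \<phi> (avg F) \<le> s * ?\<mu> i"
            using mult_left_mono[of "s - \<eta>" "\<phi> (avg F)" "?\<mu> i"] mult_left_mono[of "\<phi> (avg F)" s "?\<mu> i"]
            by (simp_all add: mult.commute)
        qed
        moreover have "\<phi> (?d i) = \<phi> (\<nu> (G i)) - ?\<mu> i * \<phi> (avg F)" by (simp add: linear_diff[OF lin] linear_scale[OF lin])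
        moreover have "(s - \<eta>) * ?\<mu> i = s * ?\<mu> i - \<eta> * ?\<mu> i" by (simp add: algebra_simps)
        ultimately have "\<bar>\<phi> (?d i)\<bar> \<le> \<eta> * ?\<mu> i" by linarith
        moreover have "norm (?d i) \<le> norm (L (?d i)) + \<bar>\<phi> (?d i)\<bar>"
        proof -
          have "?d i = L (?d i) + \<phi> (?d i) *\<^sub>R x0" by (simp add: L_def)
          then have "norm (?d i) \<le> norm (L (?d i)) + norm (\<phi> (?d i) *\<^sub>R x0)" by (metis norm_triangle_ineq)
          then show ?thesis using x0(2) by simp
        qed
        moreover have "L (?d i) = - (?\<mu> i *\<^sub>R (b - \<beta> i))"
        proof -
          have "?\<mu> i *\<^sub>R b = L (?\<mu> i *\<^sub>R avg F) + ?\<mu> i *\<^sub>R x0"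
            by (simp add: F(1) c_def scaleR_add_right linear_scale[OF linL])
          then show ?thesis using \<mu>\<beta>[of i] by (simp add: linear_diff[OF linL] scaleR_diff_right)
        qed
        then have "norm (L (?d i)) = ?\<mu> i * norm (b - \<beta> i)" by simp
        ultimately show ?thesis by linarith
      qed
      have "\<epsilon> / 8 * measure M F = \<epsilon> / 4 * measure M F - \<eta> * (\<Sum>i<m. ?\<mu> i)" using G(4) by (simp add: \<eta>_def)
      also have "\<dots> \<le> (\<Sum>i<m. norm (?d i)) - (\<Sum>i<m. \<eta> * ?\<mu> i)" using G(5) by (simp add: sum_distrib_left)
      also have "\<dots> = (\<Sum>i<m. norm (?d i) - \<eta> * ?\<mu> i)" by (rule sum_subtractf[symmetric])
      also have "\<dots> \<le> (\<Sum>i<m. ?\<mu> i * norm (b - \<beta> i))" by (rule sum_mono) (rule piece)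
      finally have "\<epsilon> / 8 \<le> (\<Sum>i<m. ?\<mu> i * norm (b - \<beta> i)) / measure M F" using F'(3) by (simp add: pos_le_divide_eq)
      then show ?thesis by (simp add: w_def sum_divide_distrib)
    qed
    ultimately show ?thesis by (intro exI[of _ m] exI[of _ w] exI[of _ \<beta>]) simp
  qed
  have "\<forall>b\<in>B. \<exists>p::nat \<times> (nat \<Rightarrow> real) \<times> (nat \<Rightarrow> 'x). (\<forall>i<fst p. snd (snd p) i \<in> B \<and> 0 \<le> fst (snd p) i) \<and>
      sum (fst (snd p)) {..<fst p} = 1 \<and> (\<Sum>i<fst p. fst (snd p) i *\<^sub>R snd (snd p) i) = b \<and>
      \<epsilon> / 8 \<le> (\<Sum>i<fst p. fst (snd p) i * norm (b - snd (snd p) i))"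
    using split by simp
  from bchoice[OF this] obtain p :: "'x \<Rightarrow> nat \<times> (nat \<Rightarrow> real) \<times> (nat \<Rightarrow> 'x)" where
    p: "\<forall>b\<in>B. (\<forall>i<fst (p b). snd (snd (p b)) i \<in> B \<and> 0 \<le> fst (snd (p b)) i) \<and>
      sum (fst (snd (p b))) {..<fst (p b)} = 1 \<and> (\<Sum>i<fst (p b). fst (snd (p b)) i *\<^sub>R snd (snd (p b)) i) = b \<and>
      \<epsilon> / 8 \<le> (\<Sum>i<fst (p b). fst (snd (p b)) i * norm (b - snd (snd (p b)) i))" ..
  have "bush \<phi> B C (\<epsilon> / 8) (\<lambda>b. fst (p b)) (\<lambda>b. fst (snd (p b))) (\<lambda>b. snd (snd (p b)))"
  proof (rule bush.intro)
    show "bounded_linear \<phi>" by fact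
    show "0 < \<epsilon> / 8" using \<epsilon> by simp
    fix b assume b: "b \<in> B"
    show "\<phi> b = 1" "norm b \<le> C" using b \<phi>c norm_c by (auto simp: B_def)
  qed (use p in auto)
  moreover have "B \<noteq> {}" using F0 by (auto simp: B_def pos_def)
  ultimately show ?thesis by blast
qed

end

theorem theorem1p2:
  assumes "\<not> RNP TYPE('w) TYPE('x::banach)"
  shows "\<exists>(M :: 'x set) (d :: 'x \<Rightarrow> 'x \<Rightarrow> real) (u :: 'x) (v :: 'x) (T :: (real \<Rightarrow> 'x) set).
           Metric_space M d \<and> u \<in> M \<and> v \<in> M \<and>
           T \<noteq> {} \<and> thick_family M d u v T \<and>
           (\<exists>f :: 'x \<Rightarrow> 'x. bilipschitz_embedding M d f)"
proof -
  obtain \<mu> :: "'w measure" and \<nu> :: "'w set \<Rightarrow> 'x" where "finite_measure \<mu>"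
    and \<nu>: "vector_measure_on \<mu> \<nu>" "bounded_variation_on \<mu> \<nu>" "vanishes_on_null_sets \<mu> \<nu>"
    and no_density: "\<not> (\<exists>f. \<forall>E\<in>sets \<mu>. has_strong_bochner_integral \<mu> (\<lambda>w. indicator E w *\<^sub>R f w) (\<nu> E))"
    using assms unfolding RNP_def RNP_wrt_def by blast
  then interpret vector_measure \<mu> \<nu>
    by (simp add: vector_measure_def vector_measure_axioms_def)
  obtain \<phi> :: "'x \<Rightarrow> real" and B C \<delta> n w \<beta> where "bush \<phi> B C \<delta> n w \<beta>" and "B \<noteq> {}"
    using bush_exists[OF no_density] by blast
  then interpret bush \<phi> B C \<delta> n w \<beta> by simp
  obtain b where "b \<in> B" using \<open>B \<noteq> {}\<close> by blast
  then show ?thesis by (rule thick_family_exists)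
qed

end
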